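(* Let $G$ be a topological group, let $\{\alpha_n\}$ be a sequence of continuous actions of $G$ on bounded Polish metric spaces $\{X_n\}$, and let $C>0$, $p\ge1$, $a,b>0$. For every $n\in\mathbb{N}$ let $(\alpha_n)_\sharp$ be the induced action of $\alpha_n$ on the space $(\mathcal{M}_p^C(X_n),W_p^{a,b})$. Suppose that $\lim_{n\to\infty}d_{mGH}(\alpha_n,\alpha)=0$ for some continuous action $\alpha$ of $G$ on a bounded Polish metric space $X$, and let $\alpha_\sharp$ be the induced action of $\alpha$ on the space $(\mathcal{M}_p^C(X),W_p^{a,b})$. Then $\lim_{n\to\infty}d_{mGH}((\alpha_n)_\sharp,\alpha_\sharp)=0$.
   Context: A Polish metric space is a complete separable metric space. For bounded metric spaces $(Y_1,d_1),(Y_2,d_2)$, an $\varepsilon$-Gromov-Hausdorff approximation (also called $\varepsilon$-isometry) from $Y_1$ to $Y_2$ is a (not necessarily continuous) map $f:Y_1\to Y_2$ such that $|d_2(f(x),f(x'))-d_1(x,x')|\le\varepsilon$ for all $x,x'\in Y_1$, and for every $y\in Y_2$ there is $x\in Y_1$ with $d_2(f(x),y)\le\varepsilon$. Let $\alpha,\beta$ be continuous actions of $G$ on $(Y_1,d_1),(Y_2,d_2)$, with $\alpha_g,\beta_g$ the maps given by $g\in G$. An $\varepsilon$-GH approximation from $\alpha$ to $\beta$ is an $\varepsilon$-isometry $f:Y_1\to Y_2$ such that $\sup_{x\in Y_1}d_2(f(\alpha_g(x)),\beta_g(f(x)))\le\varepsilon$ for every $g\in G$; it is an $\varepsilon$-measurable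 GH approximation if moreover $f$ is (Borel) measurable. $d_{mGH}(\alpha,\beta)$ is the infimum of $\varepsilon>0$ such that there exist $\varepsilon$-measurable GH approximations from $\alpha$ to $\beta$ and from $\beta$ to $\alpha$ ($\infty$ if there is no such $\varepsilon$). $\mathcal{M}(X)$ is the set of nonnegative Borel measures on $X$ with finite mass; $\mathcal{M}_p(X)$ is the set of $\mu\in\mathcal{M}(X)$ with $\int_X d(x,x_0)^p\,d\mu(x)<\infty$ for some (equivalently any) $x_0\in X$ (all of $\mathcal{M}(X)$ when $X$ is bounded). For $\mu\in\mathcal{M}(X)$, $|\mu|:=\mu(X)$, and $|\mu-\nu|$ denotes the total variation mass of the signed measure $\mu-\nu$. $\mathcal{M}_p^C(X):=\{\mu\in\mathcal{M}_p(X):|\mu|\le C\}$. The push-forward is $f_\sharp\mu(B)=\mu(f^{-1}(B))$, and the induced action $\alpha_\sharp$ on $\mathcal{M}_p^C(X)$ is $\alpha_{\sharp,g}(\mu)=(\alpha_g)_\sharp\mu$. For $\mu,\nu\in\mathcal{M}(X)$ with $|\mu|=|\nu|$, $\Pi(\mu,\nu)$ is the set of Borel probability measures $\pi$ on $X\times X$ with $|\mu|\pi(A\times X)=\mu(A)$ and $|\nu|\pi(X\times B)=\nu(B)$ for all Borel $A,B\subset X$; for $\mu,\nu\in\mathcal{M}_p(X)$ with $|\mu|=|\nu|$, $W_p(\mu,\nu):=\left(|\mu|\inf_{\pi\in\Pi(\mu,\nu)}\int_{X\times X}d(x,y)^p\,d\pi(x,y)\right)^{1/p}$. The generalized Wasserstein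 distance is $$W_p^{a,b}(\mu,\nu):=\inf\{a|\mu-\widetilde\mu|+a|\nu-\widetilde\nu|+b\,W_p(\widetilde\mu,\widetilde\nu)\;:\;\widetilde\mu,\widetilde\nu\in\mathcal{M}_p(X),\ |\widetilde\mu|=|\widetilde\nu|\}.$$ *)

theory Defs
  imports "HOL-Probability.Probability" "HOL-Algebra.Group_Action"
begin

locale topological_group = group G for G (structure) +
  fixes T :: "'a topology"
  assumes topspace_eq: "topspace T = carrier G"
    and continuous_mult: "continuous_map (prod_topology T T) T (\<lambda>(x, y). x \<otimes> y)"
    and continuous_inv: "continuous_map T T (\<lambda>x. inv x)"

definition bounded_polish_metric_space :: "'a set \<Rightarrow> ('a \<Rightarrow> 'a \<Rightarrow> real) \<Rightarrow> bool" where
  "bounded_polish_metric_space X d \<longleftrightarrow>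
     Metric_space X d \<and>
     Metric_space.mcomplete X d \<and>
     separable_space (Metric_space.mtopology X d) \<and>
     Metric_space.mbounded X d X"

definition borel_of :: "'a topology \<Rightarrow> 'a measure" where
  "borel_of T = sigma (topspace T) {U. openin T U}"

abbreviation metric_borel :: "'a set \<Rightarrow> ('a \<Rightarrow> 'a \<Rightarrow> real) \<Rightarrow> 'a measure" where
  "metric_borel X d \<equiv> borel_of (Metric_space.mtopology X d)"

(* As a consequence of group_action, every map \<alpha> g is extensional, i.e. undefined outside X. *)
definition continuous_action ::
  "('g, 'm) monoid_scheme \<Rightarrow> 'g topology \<Rightarrow> 'a set \<Rightarrow> ('a \<Rightarrow> 'a \<Rightarrow> real) \<Rightarrow> ('g \<Rightarrow> 'a \<Rightarrow> 'a) \<Rightarrow> bool" where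
  "continuous_action G T X d \<alpha> \<longleftrightarrow>
     group_action G X \<alpha> \<and>
     continuous_map (prod_topology T (Metric_space.mtopology X d)) (Metric_space.mtopology X d)
       (\<lambda>(g, x). \<alpha> g x)"


subsection \<open>Gromov-Hausdorff approximations\<close>

definition eps_isometry ::
  "'a set \<Rightarrow> ('a \<Rightarrow> 'a \<Rightarrow> real) \<Rightarrow> 'b set \<Rightarrow> ('b \<Rightarrow> 'b \<Rightarrow> real) \<Rightarrow> real \<Rightarrow> ('a \<Rightarrow> 'b) \<Rightarrow> bool" where
  "eps_isometry Y1 d1 Y2 d2 \<epsilon> f \<longleftrightarrow>
     f \<in> Y1 \<rightarrow> Y2 \<and>
     (\<forall>x\<in>Y1. \<forall>x'\<in>Y1. \<bar>d2 (f x) (f x') - d1 x x'\<bar> \<le> \<epsilon>) \<and>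
     (\<forall>y\<in>Y2. \<exists>x\<in>Y1. d2 (f x) y \<le> \<epsilon>)"

definition GH_approximation ::
  "('g, 'm) monoid_scheme \<Rightarrow> 'a set \<Rightarrow> ('a \<Rightarrow> 'a \<Rightarrow> real) \<Rightarrow> ('g \<Rightarrow> 'a \<Rightarrow> 'a)
   \<Rightarrow> 'b set \<Rightarrow> ('b \<Rightarrow> 'b \<Rightarrow> real) \<Rightarrow> ('g \<Rightarrow> 'b \<Rightarrow> 'b) \<Rightarrow> real \<Rightarrow> ('a \<Rightarrow> 'b) \<Rightarrow> bool" where
  "GH_approximation G Y1 d1 \<alpha> Y2 d2 \<beta> \<epsilon> f \<longleftrightarrow>
     eps_isometry Y1 d1 Y2 d2 \<epsilon> f \<and>
     (\<forall>g\<in>carrier G. \<forall>x\<in>Y1. d2 (f (\<alpha> g x)) (\<beta> g (f x)) \<le> \<epsilon>)"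

definition measurable_GH_approximation ::
  "('g, 'm) monoid_scheme \<Rightarrow> 'a set \<Rightarrow> ('a \<Rightarrow> 'a \<Rightarrow> real) \<Rightarrow> ('g \<Rightarrow> 'a \<Rightarrow> 'a)
   \<Rightarrow> 'b set \<Rightarrow> ('b \<Rightarrow> 'b \<Rightarrow> real) \<Rightarrow> ('g \<Rightarrow> 'b \<Rightarrow> 'b) \<Rightarrow> real \<Rightarrow> ('a \<Rightarrow> 'b) \<Rightarrow> bool" where
  "measurable_GH_approximation G Y1 d1 \<alpha> Y2 d2 \<beta> \<epsilon> f \<longleftrightarrow>
     GH_approximation G Y1 d1 \<alpha> Y2 d2 \<beta> \<epsilon> f \<and>
     f \<in> metric_borel Y1 d1 \<rightarrow>\<^sub>M metric_borel Y2 d2"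

(* The infimum is taken in ereal, so it is \<infinity> when there is no admissible \<epsilon>. *)
definition d_mGH ::
  "('g, 'm) monoid_scheme \<Rightarrow> 'a set \<Rightarrow> ('a \<Rightarrow> 'a \<Rightarrow> real) \<Rightarrow> ('g \<Rightarrow> 'a \<Rightarrow> 'a)
   \<Rightarrow> 'b set \<Rightarrow> ('b \<Rightarrow> 'b \<Rightarrow> real) \<Rightarrow> ('g \<Rightarrow> 'b \<Rightarrow> 'b) \<Rightarrow> ereal" where
  "d_mGH G Y1 d1 \<alpha> Y2 d2 \<beta> =
     (INF \<epsilon>\<in>{\<epsilon>. 0 < \<epsilon> \<and>
                (\<exists>f. measurable_GH_approximation G Y1 d1 \<alpha> Y2 d2 \<beta> \<epsilon> f) \<and>
                (\<exists>h. measurable_GH_approximation G Y2 d2 \<beta> Y1 d1 \<alpha> \<epsilon> h)}. ereal \<epsilon>)"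


subsection \<open>Spaces of finite measures and the generalized Wasserstein distance\<close>

definition finite_borel_measures :: "'a set \<Rightarrow> ('a \<Rightarrow> 'a \<Rightarrow> real) \<Rightarrow> 'a measure set" where
  "finite_borel_measures X d = {\<mu>. sets \<mu> = sets (metric_borel X d) \<and> finite_measure \<mu>}"

(* The moment condition does not depend on the base point; quantifying universally over it
   also gives the right space (containing the zero measure) when X is empty. *)
definition measures_p :: "'a set \<Rightarrow> ('a \<Rightarrow> 'a \<Rightarrow> real) \<Rightarrow> real \<Rightarrow> 'a measure set" where
  "measures_p X d p =
     {\<mu> \<in> finite_borel_measures X d.
        \<forall>x0\<in>X. (\<integral>\<^sup>+x. ennreal (d x x0 powr p) \<partial>\<mu>) < \<infinity>}"

definition mass :: "'a measure \<Rightarrow> real" where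
  "mass \<mu> = measure \<mu> (space \<mu>)"

definition measures_p_C :: "'a set \<Rightarrow> ('a \<Rightarrow> 'a \<Rightarrow> real) \<Rightarrow> real \<Rightarrow> real \<Rightarrow> 'a measure set" where
  "measures_p_C X d p C = {\<mu> \<in> measures_p X d p. mass \<mu> \<le> C}"

definition induced_action ::
  "'a set \<Rightarrow> ('a \<Rightarrow> 'a \<Rightarrow> real) \<Rightarrow> real \<Rightarrow> real \<Rightarrow> ('g \<Rightarrow> 'a \<Rightarrow> 'a) \<Rightarrow> 'g \<Rightarrow> 'a measure \<Rightarrow> 'a measure" where
  "induced_action X d p C \<alpha> g = (\<lambda>\<mu>\<in>measures_p_C X d p C. distr \<mu> (metric_borel X d) (\<alpha> g))"

(* Total variation mass of the signed measure \<mu> - \<nu>, for finite \<mu> and \<nu> on the same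
   sigma-algebra, as a supremum over finite measurable partitions. *)
definition tv_mass_diff :: "'a measure \<Rightarrow> 'a measure \<Rightarrow> real" where
  "tv_mass_diff \<mu> \<nu> =
     enn2real (SUP P\<in>{P. finite P \<and> P \<subseteq> sets \<mu> \<and> partition_on (space \<mu>) P}.
                 ennreal (\<Sum>A\<in>P. \<bar>measure \<mu> A - measure \<nu> A\<bar>))"

definition transport_plans ::
  "'a set \<Rightarrow> ('a \<Rightarrow> 'a \<Rightarrow> real) \<Rightarrow> 'a measure \<Rightarrow> 'a measure \<Rightarrow> ('a \<times> 'a) measure set" where
  "transport_plans X d \<mu> \<nu> =
     {\<pi>. sets \<pi> = sets (borel_of (prod_topology (Metric_space.mtopology X d) (Metric_space.mtopology X d))) \<and>
          prob_space \<pi> \<and>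
          (\<forall>A\<in>sets (metric_borel X d). mass \<mu> * measure \<pi> (A \<times> X) = measure \<mu> A) \<and>
          (\<forall>B\<in>sets (metric_borel X d). mass \<nu> * measure \<pi> (X \<times> B) = measure \<nu> B)}"

(* The infimum is finite for \<mu>, \<nu> in measures_p X d p with equal positive mass. For the zero
   measure the product is 0, also if X is empty and there are no plans, since 0 * \<infinity> = 0. *)
definition wasserstein ::
  "'a set \<Rightarrow> ('a \<Rightarrow> 'a \<Rightarrow> real) \<Rightarrow> real \<Rightarrow> 'a measure \<Rightarrow> 'a measure \<Rightarrow> real" where
  "wasserstein X d p \<mu> \<nu> =
     enn2real (ennreal (mass \<mu>) *
       (INF \<pi>\<in>transport_plans X d \<mu> \<nu>. \<integral>\<^sup>+(x, y). ennreal (d x y powr p) \<partial>\<pi>)) powr (1 / p)"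

definition gen_wasserstein ::
  "'a set \<Rightarrow> ('a \<Rightarrow> 'a \<Rightarrow> real) \<Rightarrow> real \<Rightarrow> real \<Rightarrow> real \<Rightarrow> 'a measure \<Rightarrow> 'a measure \<Rightarrow> real" where
  "gen_wasserstein X d p a b \<mu> \<nu> =
     Inf {a * tv_mass_diff \<mu> \<mu>' + a * tv_mass_diff \<nu> \<nu>' + b * wasserstein X d p \<mu>' \<nu>' | \<mu>' \<nu>'.
            \<mu>' \<in> measures_p X d p \<and> \<nu>' \<in> measures_p X d p \<and> mass \<mu>' = mass \<nu>'}"

end

theory Submission
  imports Defs
begin

text \<open>
  Let \<open>f\<close> be a measurable \<open>\<epsilon>\<close>-approximation between actions on bounded separable metric spaces. Then
  the push-forward \<open>\<mu> \<mapsto> f\<^sub>\<sharp>\<mu>\<close> is a measurable approximation between the induced actions with error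
  \<open>11 b (3C + 1)\<^bsup>1/p\<^esup> \<epsilon>\<close> (\<open>induced_measurable_GH_approximation\<close>). This constant does not depend on
  the spaces, so convergence to zero is inherited.

  The metric estimates rest on one reformulation. The definition of \<open>W(\<mu>, \<nu>)\<close> has two nested
  infima: first one replaces \<open>\<mu>\<close> and \<open>\<nu>\<close> by measures of equal mass, then one transports these.
  Both choices together amount to the choice of a single finite measure \<open>P\<close> on \<open>X \<times> X\<close>, whose
  marginals are the replacements. Hence \<open>W(\<mu>, \<nu>)\<close> is the infimum of
  \<open>a |\<mu> - P\<^sub>1| + a |\<nu> - P\<^sub>2| + b (\<integral> d\<^sup>p dP)\<^bsup>1/p\<^esup>\<close> over all such \<open>P\<close>, and a bound for \<open>W\<close> is proved by
  writing down a measure \<open>P\<close>. The image of \<open>P\<close> under \<open>f \<times> f\<close> shows that \<open>f\<^sub>\<sharp>\<close> enlarges distances by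
  \<open>O(\<epsilon>)\<close> only; here the mass of \<open>P\<close> matters, and it is at most \<open>3C + 1\<close> for a nearly optimal \<open>P\<close>. The image
  of \<open>\<mu>\<close> under a pair \<open>(F, H)\<close> of maps at distance at most \<open>\<eta>\<close> shows that \<open>F\<^sub>\<sharp>\<mu>\<close> and \<open>H\<^sub>\<sharp>\<mu>\<close> are \<open>O(\<eta>)\<close>-close,
  which gives approximate equivariance. A countably valued measurable map \<open>g\<close> with \<open>f \<circ> g\<close> near the
  identity gives approximate surjectivity and, by the triangle inequality, the lower distance bound.

  The map \<open>f\<close> need not be continuous, so \<open>f\<^sub>\<sharp>\<close> need not be continuous either, and its Borel
  measurability needs an argument of its own. On the source side, evaluation at an open set is lower
  semicontinuous for \<open>W\<close> by a Markov-type estimate, so evaluation at every Borel set is Borel. On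
  the target side, every \<open>W\<close>-open set is a countable union of sets that constrain only the
  masses of countably many small cells, since two measures with nearly the same
  cell masses are \<open>W\<close>-close (\<open>W_le_cells\<close>). Preimages under \<open>f\<^sub>\<sharp>\<close> of such sets are described by evaluations.

  The topology of the space of measures is that of a metric, so \<open>W\<close> has to be shown to be one. By the
  Markov-type estimate, measures at distance zero agree. For the triangle inequality, two partial plans are
  glued along their middle coordinates. Instead of disintegrating the plans, one cuts the space into
  countably many cells of small diameter and glues cell by cell. In each cell only the smaller
  of the two masses is kept; the total loss is the total variation of the middle marginals on the cells,
  which the terms of the definition pay for.
\<close>

section \<open>Total variation and integral inequalities\<close>

lemma tv_mass_diff_le:
  assumes "\<And>P. finite P \<Longrightarrow> P \<subseteq> sets \<mu> \<Longrightarrow> partition_on (space \<mu>) P \<Longrightarrow>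
              (\<Sum>A\<in>P. \<bar>measure \<mu> A - measure \<nu> A\<bar>) \<le> r"
    and "0 \<le> r"
  shows "tv_mass_diff \<mu> \<nu> \<le> r"
  unfolding tv_mass_diff_def
  by (rule enn2real_leI) (auto intro!: SUP_least ennreal_leI assms)

lemma sum_measure_disjoint_le:
  assumes "finite_measure \<mu>" "finite I" "\<And>i. i \<in> I \<Longrightarrow> A i \<in> sets \<mu>" "disjoint_family_on A I"
  shows "(\<Sum>i\<in>I. measure \<mu> (A i)) \<le> measure \<mu> (space \<mu>)"
proof -
  interpret finite_measure \<mu> by fact
  have "(\<Sum>i\<in>I. measure \<mu> (A i)) = measure \<mu> (\<Union>i\<in>I. A i)"
    using assms by (intro finite_measure_finite_Union[symmetric]) auto
  also have "\<dots> \<le> measure \<mu> (space \<mu>)"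
    using assms by (intro bounded_measure)
  finally show ?thesis .
qed

lemma partition_on_disjoint_family:
  "partition_on S P \<Longrightarrow> disjoint_family_on (\<lambda>A. A) P"
  by (auto simp: partition_on_def disjoint_def disjoint_family_on_def)

lemma tv_mass_diff_ge_partition:
  assumes fin: "finite_measure \<mu>" "finite_measure \<nu>" and s: "sets \<nu> = sets \<mu>"
    and P: "finite P" "P \<subseteq> sets \<mu>" "partition_on (space \<mu>) P"
  shows "(\<Sum>A\<in>P. \<bar>measure \<mu> A - measure \<nu> A\<bar>) \<le> tv_mass_diff \<mu> \<nu>"
proof -
  let ?S = "SUP P\<in>{P. finite P \<and> P \<subseteq> sets \<mu> \<and> partition_on (space \<mu>) P}.
                 ennreal (\<Sum>A\<in>P. \<bar>measure \<mu> A - measure \<nu> A\<bar>)"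
  have bd: "(\<Sum>A\<in>Q. \<bar>measure \<mu> A - measure \<nu> A\<bar>) \<le> mass \<mu> + mass \<nu>"
    if Q: "finite Q" "Q \<subseteq> sets \<mu>" "partition_on (space \<mu>) Q" for Q
  proof -
    have "(\<Sum>A\<in>Q. \<bar>measure \<mu> A - measure \<nu> A\<bar>) \<le> (\<Sum>A\<in>Q. measure \<mu> A) + (\<Sum>A\<in>Q. measure \<nu> A)"
      unfolding sum.distrib[symmetric] by (intro sum_mono order_trans[OF abs_triangle_ineq4]) simp
    also have "\<dots> \<le> mass \<mu> + mass \<nu>"
      unfolding mass_def using Q s
      by (intro add_mono sum_measure_disjoint_le fin)
         (auto intro: partition_on_disjoint_family)
    finally show ?thesis .
  qed
  have "?S \<le> ennreal (mass \<mu> + mass \<nu>)"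
    by (intro SUP_least ennreal_leI bd) auto
  then have "?S < top_class.top" using ennreal_less_top le_less_trans by blast
  moreover have "ennreal (\<Sum>A\<in>P. \<bar>measure \<mu> A - measure \<nu> A\<bar>) \<le> ?S"
    using P by (intro SUP_upper) auto
  ultimately have "enn2real (ennreal (\<Sum>A\<in>P. \<bar>measure \<mu> A - measure \<nu> A\<bar>)) \<le> enn2real ?S"
    by (intro enn2real_mono)
  then show ?thesis
    unfolding tv_mass_diff_def by (simp add: sum_nonneg)
qed

text \<open>A disjoint family need not cover the space and may have empty members, which
  makes it easier to use than a partition, for instance for preimages and for the cells of an index map.\<close>

lemma tv_mass_diff_ge:
  assumes fin: "finite_measure \<mu>" "finite_measure \<nu>" and s: "sets \<nu> = sets \<mu>"
    and I: "finite I" "\<And>i. i \<in> I \<Longrightarrow> A i \<in> sets \<mu>" "disjoint_family_on A I"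
  shows "(\<Sum>i\<in>I. \<bar>measure \<mu> (A i) - measure \<nu> (A i)\<bar>) \<le> tv_mass_diff \<mu> \<nu>"
proof -
  define J where "J = {i\<in>I. A i \<noteq> {}}"
  define R where "R = space \<mu> - (\<Union>i\<in>I. A i)"
  define P where "P = (A ` J \<union> {R}) - {{}}"
  have fJ: "finite J" using I by (simp add: J_def)
  have inj: "inj_on A J"
    using I(3) by (auto simp: J_def inj_on_def disjoint_family_on_def)
  have R: "R \<in> sets \<mu>" unfolding R_def using I by auto
  have AJ: "A ` J \<subseteq> P" by (auto simp: P_def J_def)
  have fP: "finite P" using fJ by (simp add: P_def)
  have Ps: "P \<subseteq> sets \<mu>" using I(2) R by (auto simp: P_def J_def)
  have part: "partition_on (space \<mu>) P"
  proof (rule partition_onI)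
    have "\<Union>P = (\<Union>i\<in>I. A i) \<union> R" by (auto simp: P_def J_def)
    moreover have "(\<Union>i\<in>I. A i) \<subseteq> space \<mu>"
      using sets.sets_into_space[OF I(2)] by blast
    ultimately show "\<Union>P = space \<mu>" by (auto simp: R_def)
    show "disjnt p q" if "p \<in> P" "q \<in> P" "p \<noteq> q" for p q
    proof -
      have "disjnt (A i) (A j)" if "i \<in> I" "j \<in> I" "A i \<noteq> A j" for i j
        using that I(3) by (metis disjoint_family_on_def disjnt_def)
      moreover have "disjnt (A i) R" "disjnt R (A i)" if "i \<in> I" for i
        using that by (auto simp: R_def disjnt_def)
      ultimately show ?thesis using that by (auto simp: P_def J_def)
    qed
    show "{} \<notin> P" by (simp add: P_def)
  qed
  have "(\<Sum>i\<in>I. \<bar>measure \<mu> (A i) - measure \<nu> (A i)\<bar>) = (\<Sum>i\<in>J. \<bar>measure \<mu> (A i) - measure \<nu> (A i)\<bar>)"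
    using I(1) by (intro sum.mono_neutral_right) (auto simp: J_def)
  also have "\<dots> = (\<Sum>B\<in>A ` J. \<bar>measure \<mu> B - measure \<nu> B\<bar>)"
    using inj by (simp add: sum.reindex)
  also have "\<dots> \<le> (\<Sum>B\<in>P. \<bar>measure \<mu> B - measure \<nu> B\<bar>)"
    using fP AJ by (intro sum_mono2) auto
  also have "\<dots> \<le> tv_mass_diff \<mu> \<nu>"
    by (intro tv_mass_diff_ge_partition fin s fP Ps part)
  finally show ?thesis .
qed

lemma tv_mass_diff_nonneg [simp]: "0 \<le> tv_mass_diff \<mu> \<nu>"
  by (simp add: tv_mass_diff_def)

lemma tv_mass_diff_ge_single:
  assumes "finite_measure \<mu>" "finite_measure \<nu>" "sets \<nu> = sets \<mu>" "A \<in> sets \<mu>"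
  shows "\<bar>measure \<mu> A - measure \<nu> A\<bar> \<le> tv_mass_diff \<mu> \<nu>"
  using tv_mass_diff_ge[OF assms(1-3), of "{()}" "\<lambda>_. A"] assms(4) by (simp add: disjoint_family_on_def)

lemma tv_mass_diff_refl [simp]: "tv_mass_diff \<mu> \<mu> = 0"
proof -
  have "tv_mass_diff \<mu> \<mu> \<le> 0" by (rule tv_mass_diff_le) auto
  then show ?thesis using tv_mass_diff_nonneg[of \<mu> \<mu>] by linarith
qed

lemma tv_mass_diff_commute:
  assumes "sets \<nu> = sets \<mu>"
  shows "tv_mass_diff \<mu> \<nu> = tv_mass_diff \<nu> \<mu>"
  unfolding tv_mass_diff_def assms sets_eq_imp_space_eq[OF assms] abs_minus_commute ..

lemma tv_mass_diff_triangle: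
  assumes fin: "finite_measure \<mu>" "finite_measure \<nu>" "finite_measure \<rho>"
    and s: "sets \<nu> = sets \<mu>" "sets \<rho> = sets \<mu>"
  shows "tv_mass_diff \<mu> \<rho> \<le> tv_mass_diff \<mu> \<nu> + tv_mass_diff \<nu> \<rho>"
proof (rule tv_mass_diff_le)
  fix P assume P: "finite P" "P \<subseteq> sets \<mu>" "partition_on (space \<mu>) P"
  have "(\<Sum>A\<in>P. \<bar>measure \<mu> A - measure \<rho> A\<bar>)
      \<le> (\<Sum>A\<in>P. \<bar>measure \<mu> A - measure \<nu> A\<bar>) + (\<Sum>A\<in>P. \<bar>measure \<nu> A - measure \<rho> A\<bar>)"
    unfolding sum.distrib[symmetric] by (intro sum_mono) linarith
  also have "\<dots> \<le> tv_mass_diff \<mu> \<nu> + tv_mass_diff \<nu> \<rho>"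
    using P s sets_eq_imp_space_eq[OF s(1)]
    by (intro add_mono tv_mass_diff_ge_partition fin) auto
  finally show "(\<Sum>A\<in>P. \<bar>measure \<mu> A - measure \<rho> A\<bar>) \<le> tv_mass_diff \<mu> \<nu> + tv_mass_diff \<nu> \<rho>" .
qed simp

lemma tv_mass_diff_distr:
  assumes fin: "finite_measure \<mu>" "finite_measure \<nu>" and s: "sets \<nu> = sets \<mu>"
    and f: "f \<in> \<mu> \<rightarrow>\<^sub>M N"
  shows "tv_mass_diff (distr \<mu> N f) (distr \<nu> N f) \<le> tv_mass_diff \<mu> \<nu>"
proof (rule tv_mass_diff_le)
  fix P assume P: "finite P" "P \<subseteq> sets (distr \<mu> N f)" "partition_on (space (distr \<mu> N f)) P"
  have f': "f \<in> \<nu> \<rightarrow>\<^sub>M N" using f s by (simp cong: measurable_cong_sets)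
  have "(\<Sum>A\<in>P. \<bar>measure (distr \<mu> N f) A - measure (distr \<nu> N f) A\<bar>)
      = (\<Sum>A\<in>P. \<bar>measure \<mu> (f -` A \<inter> space \<mu>) - measure \<nu> (f -` A \<inter> space \<mu>)\<bar>)"
    using P(2) f f' sets_eq_imp_space_eq[OF s]
    by (intro sum.cong refl) (simp add: measure_distr subset_iff)
  also have "\<dots> \<le> tv_mass_diff \<mu> \<nu>"
    using P f partition_on_disjoint_family[OF P(3)]
    by (intro tv_mass_diff_ge fin s) (auto intro: measurable_sets simp: disjoint_family_on_def)
  finally show "(\<Sum>A\<in>P. \<bar>measure (distr \<mu> N f) A - measure (distr \<nu> N f) A\<bar>) \<le> tv_mass_diff \<mu> \<nu>" .
qed simp

text \<open>The differences on the parts of a partition are nonnegative, so their sum telescopes.\<close>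

lemma tv_mass_diff_dominated:
  assumes fin: "finite_measure \<mu>" "finite_measure \<nu>" and s: "sets \<nu> = sets \<mu>"
    and le: "\<And>A. A \<in> sets \<mu> \<Longrightarrow> measure \<nu> A \<le> measure \<mu> A"
  shows "tv_mass_diff \<mu> \<nu> \<le> mass \<mu> - mass \<nu>"
proof (rule tv_mass_diff_le)
  have sp: "space \<nu> = space \<mu>" using s by (rule sets_eq_imp_space_eq)
  show "0 \<le> mass \<mu> - mass \<nu>" using le[of "space \<mu>"] by (simp add: mass_def sp)
  fix P assume P: "finite P" "P \<subseteq> sets \<mu>" "partition_on (space \<mu>) P"
  have *: "(\<Sum>A\<in>P. measure M A) = mass M" if "finite_measure M" "sets M = sets \<mu>" for M
  proof -
    interpret finite_measure M by fact
    have "(\<Sum>A\<in>P. measure M A) = measure M (\<Union>A\<in>P. A)"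
      using P that partition_on_disjoint_family[OF P(3)]
      by (intro finite_measure_finite_Union[symmetric]) auto
    also have "(\<Union>A\<in>P. A) = space M"
      using P(3) sets_eq_imp_space_eq[OF that(2)] by (auto simp: partition_on_def)
    finally show ?thesis by (simp add: mass_def)
  qed
  have "(\<Sum>A\<in>P. \<bar>measure \<mu> A - measure \<nu> A\<bar>) = (\<Sum>A\<in>P. measure \<mu> A - measure \<nu> A)"
    using P le by (intro sum.cong refl) (auto simp: subset_iff)
  also have "\<dots> = mass \<mu> - mass \<nu>"
    by (simp add: sum_subtractf * fin s)
  finally show "(\<Sum>A\<in>P. \<bar>measure \<mu> A - measure \<nu> A\<bar>) \<le> mass \<mu> - mass \<nu>" by simp
qed

text \<open>Convexity up to the boundary point 0, where it says that \<open>v\<^sup>p \<le> v\<close> for \<open>v\<close> between 0 and 1.\<close>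

lemma convex_on_powr_nonneg:
  fixes p :: real
  assumes "1 \<le> p"
  shows "convex_on {0..} (\<lambda>x::real. x powr p)"
proof (rule convex_onI)
  fix u x y :: real
  assume u: "0 < u" "u < 1" and xy: "x \<in> {0..}" "y \<in> {0..}"
  have shrink: "(v * z) powr p \<le> v * z powr p" if "0 < v" "v < 1" "0 \<le> z" for v z :: real
  proof -
    have "v powr p \<le> v powr 1" using that assms by (intro powr_mono') auto
    then show ?thesis using that by (simp add: powr_mult mult_right_mono)
  qed
  consider "x = 0" | "y = 0" | "0 < x" "0 < y" using xy by force
  then show "((1 - u) *\<^sub>R x + u *\<^sub>R y) powr p \<le> (1 - u) * x powr p + u * y powr p"
  proof cases
    case 3
    then show ?thesis using convex_onD[OF powr_convex[OF assms], of u x y] u by auto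
  qed (use shrink[of u y] shrink[of "1 - u" x] u xy in auto)
qed simp

text \<open>The point \<open>(s + t) / (A + B)\<close> is the convex combination of \<open>s / A\<close> and \<open>t / B\<close> with the
  weights \<open>A / (A + B)\<close> and \<open>B / (A + B)\<close>.\<close>

lemma powr_sum_le_convex:
  fixes p s t A B :: real
  assumes "1 \<le> p" "0 \<le> s" "0 \<le> t" "0 < A" "0 < B"
  shows "(s + t) powr p \<le>
    (A + B) powr p * (A / (A + B) / A powr p) * s powr p +
    (A + B) powr p * (B / (A + B) / B powr p) * t powr p"
proof -
  have cvx: "convex_on {0..} (\<lambda>x::real. x powr p)" using assms(1) by (rule convex_on_powr_nonneg)
  have "(A / (A+B) * (s / A) + B / (A+B) * (t / B)) powr p
      \<le> A / (A+B) * (s / A) powr p + B / (A+B) * (t / B) powr p"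
  proof -
    have "1 - B/(A+B) = A/(A+B)" using assms by (simp add: field_simps)
    then show ?thesis
      using convex_onD[OF cvx, of "B/(A+B)" "s/A" "t/B"] assms by simp
  qed
  moreover have "A / (A+B) * (s / A) + B / (A+B) * (t / B) = (s + t) / (A + B)"
    using assms by (simp add: add_divide_distrib)
  ultimately have "((s + t) / (A + B)) powr p
      \<le> A / (A+B) * (s powr p / A powr p) + B / (A+B) * (t powr p / B powr p)"
    using assms by (simp add: powr_divide)
  then have "(s + t) powr p / (A + B) powr p
      \<le> A / (A+B) * (s powr p / A powr p) + B / (A+B) * (t powr p / B powr p)"
    using assms by (simp add: powr_divide)
  then have "(s + t) powr p
      \<le> (A/(A+B) * (s powr p / A powr p) + B / (A+B) * (t powr p / B powr p)) * (A + B) powr p"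
    using assms by (simp add: pos_divide_le_eq)
  also have "\<dots> = (A + B) powr p * (A / (A + B) / A powr p) * s powr p +
    (A + B) powr p * (B / (A + B) / B powr p) * t powr p"
    by (simp add: algebra_simps)
  finally show ?thesis .
qed

text \<open>Minkowski's inequality in terms of upper bounds \<open>A\<close> and \<open>B\<close> for the two norms: integrating
  the preceding convexity inequality turns both integrals into the constant \<open>(A + B)\<^sup>p\<close>. This form
  avoids roots of extended real integrals.\<close>

lemma Minkowski_nn_integral:
  fixes p A B :: real
  assumes p: "1 \<le> p" and A: "0 < A" and B: "0 < B"
    and [measurable]: "f \<in> borel_measurable M" "g \<in> borel_measurable M"
    and f0: "\<And>x. x \<in> space M \<Longrightarrow> 0 \<le> f x" and g0: "\<And>x. x \<in> space M \<Longrightarrow> 0 \<le> g x"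
    and h: "AE x in M. 0 \<le> h x \<and> h x \<le> f x + g x"
    and fA: "(\<integral>\<^sup>+x. ennreal (f x powr p) \<partial>M) \<le> ennreal (A powr p)"
    and gB: "(\<integral>\<^sup>+x. ennreal (g x powr p) \<partial>M) \<le> ennreal (B powr p)"
  shows "(\<integral>\<^sup>+x. ennreal (h x powr p) \<partial>M) \<le> ennreal ((A + B) powr p)"
proof -
  define c e where "c = (A + B) powr p * (A / (A + B) / A powr p)"
    and "e = (A + B) powr p * (B / (A + B) / B powr p)"
  have c: "0 \<le> c" "0 \<le> e" using A B by (auto simp: c_def e_def)
  have "(\<integral>\<^sup>+x. ennreal (h x powr p) \<partial>M) \<le> (\<integral>\<^sup>+x. ennreal c * ennreal (f x powr p) + ennreal e * ennreal (g x powr p) \<partial>M)"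
  proof (rule nn_integral_mono_AE, use h AE_space in eventually_elim)
    fix x assume hx: "0 \<le> h x \<and> h x \<le> f x + g x" and x: "x \<in> space M"
    have "h x powr p \<le> (f x + g x) powr p"
      using hx p by (intro powr_mono2) auto
    also have "\<dots> \<le> c * f x powr p + e * g x powr p"
      unfolding c_def e_def using powr_sum_le_convex[OF p f0[OF x] g0[OF x] A B] .
    finally show "ennreal (h x powr p) \<le> ennreal c * ennreal (f x powr p) + ennreal e * ennreal (g x powr p)"
      using c by (simp add: ennreal_mult[symmetric] ennreal_plus[symmetric] ennreal_leI del: ennreal_plus)
  qed
  also have "\<dots> = ennreal c * (\<integral>\<^sup>+x. ennreal (f x powr p) \<partial>M) + ennreal e * (\<integral>\<^sup>+x. ennreal (g x powr p) \<partial>M)"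
    by (simp add: nn_integral_add nn_integral_cmult)
  also have "\<dots> \<le> ennreal c * ennreal (A powr p) + ennreal e * ennreal (B powr p)"
    by (intro add_mono mult_left_mono fA gB) auto
  also have "\<dots> = ennreal (c * A powr p + e * B powr p)"
    using c by (simp add: ennreal_mult[symmetric] ennreal_plus[symmetric] del: ennreal_plus)
  also have "c * A powr p + e * B powr p = (A + B) powr p * (A / (A + B)) + (A + B) powr p * (B / (A + B))"
    unfolding c_def e_def using A B by simp
  also have "\<dots> = (A + B) powr p"
    using A B by (simp add: distrib_left[symmetric] add_divide_distrib[symmetric])
  finally show ?thesis .
qed

lemma nn_integral_const_powr_le:
  assumes "finite_measure M" "1 \<le> p" "0 \<le> \<eta>" "mass M \<le> c"
  shows "(\<integral>\<^sup>+x. ennreal (\<eta> powr p) \<partial>M) \<le> ennreal ((c powr (1 / p) * \<eta>) powr p)"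
proof -
  interpret finite_measure M by fact
  have c: "0 \<le> c" using assms(4) unfolding mass_def by (rule order_trans[OF measure_nonneg])
  have "(\<integral>\<^sup>+x. ennreal (\<eta> powr p) \<partial>M) = ennreal (\<eta> powr p * mass M)"
    by (simp add: mass_def emeasure_eq_measure ennreal_mult)
  also have "\<dots> \<le> ennreal (\<eta> powr p * c)"
    using assms by (intro ennreal_leI mult_left_mono) auto
  also have "\<eta> powr p * c = (c powr (1 / p) * \<eta>) powr p"
    using assms c by (simp add: powr_mult powr_powr)
  finally show ?thesis .
qed

lemma nn_integral_nat_index:
  fixes j :: "'a \<Rightarrow> nat" and h :: "nat \<Rightarrow> ennreal"
  assumes [measurable]: "j \<in> M \<rightarrow>\<^sub>M count_space UNIV"
  shows "(\<integral>\<^sup>+x. h (j x) \<partial>M) = (\<Sum>i. h i * emeasure M {x\<in>space M. j x = i})"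
proof -
  have "(\<integral>\<^sup>+x. h (j x) \<partial>M) = (\<integral>\<^sup>+x. (\<Sum>i. h i * indicator {x\<in>space M. j x = i} x) \<partial>M)"
  proof (rule nn_integral_cong)
    fix x assume "x \<in> space M"
    then have "(\<lambda>i. h i * indicator {x\<in>space M. j x = i} x) = (\<lambda>i. if i = j x then h i else 0)"
      by (auto simp: indicator_def)
    then show "h (j x) = (\<Sum>i. h i * indicator {x\<in>space M. j x = i} x)"
      using sums_single[of "j x" h] by (simp add: sums_iff)
  qed
  also have "\<dots> = (\<Sum>i. h i * emeasure M {x\<in>space M. j x = i})"
    by (subst nn_integral_suminf) (simp_all add: nn_integral_cmult_indicator)
  finally show ?thesis .
qed

section \<open>Borel structure of separable metric spaces\<close>

lemma space_borel_of [simp]: "space (borel_of S) = topspace S"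
  by (auto simp: borel_of_def intro!: space_measure_of dest: openin_subset)

lemma sets_borel_of: "sets (borel_of S) = sigma_sets (topspace S) {U. openin S U}"
  unfolding borel_of_def by (rule sets_measure_of) (auto dest: openin_subset)

lemma borel_of_open: "openin S U \<Longrightarrow> U \<in> sets (borel_of S)"
  by (simp add: sets_borel_of)

lemma measurable_into_borel_of:
  assumes "f \<in> space M \<rightarrow> topspace S"
    and "\<And>U. openin S U \<Longrightarrow> f -` U \<inter> space M \<in> sets M"
  shows "f \<in> M \<rightarrow>\<^sub>M borel_of S"
  unfolding borel_of_def
  by (rule measurable_measure_of) (use assms in \<open>auto dest: openin_subset\<close>)

lemma continuous_map_measurable:
  assumes "continuous_map S T f"
  shows "f \<in> borel_of S \<rightarrow>\<^sub>M borel_of T"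
proof (rule measurable_into_borel_of)
  show "f \<in> space (borel_of S) \<rightarrow> topspace T"
    using assms by (simp add: continuous_map_def)
  fix U assume "openin T U"
  then have "openin S {x \<in> topspace S. f x \<in> U}"
    using assms by (simp add: continuous_map_def)
  moreover have "f -` U \<inter> space (borel_of S) = {x \<in> topspace S. f x \<in> U}" by auto
  ultimately show "f -` U \<inter> space (borel_of S) \<in> sets (borel_of S)"
    by (simp add: borel_of_open)
qed

lemma continuous_map_borel_measurable:
  assumes "continuous_map S euclidean (f :: 'a \<Rightarrow> 'b::topological_space)"
  shows "f \<in> borel_measurable (borel_of S)"
proof -
  have "sets (borel_of (euclidean :: 'b topology)) = sets borel"
    by (simp add: sets_borel_of borel_def)
  then show ?thesis
    using continuous_map_measurable[OF assms] by (simp cong: measurable_cong_sets)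
qed

locale bounded_separable_metric = Metric_space X d for X :: "'a set" and d +
  assumes separable: "separable_space mtopology" and bounded: "mbounded X"
begin

abbreviation BX :: "'a measure" where "BX \<equiv> borel_of mtopology"

text \<open>In the empty space there is no such sequence and the value is arbitrary; statements about its
  members assume that \<open>X\<close> is nonempty.\<close>

definition dense_seq :: "nat \<Rightarrow> 'a" where
  "dense_seq = (SOME s. range s \<subseteq> X \<and> (\<forall>x\<in>X. \<forall>e>0. \<exists>n. d x (s n) < e))"

lemma dense_seq:
  assumes "X \<noteq> {}"
  shows "dense_seq n \<in> X" and "\<And>x e. x \<in> X \<Longrightarrow> 0 < e \<Longrightarrow> \<exists>n. d x (dense_seq n) < e"
proof -
  obtain C where C: "countable C" "C \<subseteq> X" "mtopology closure_of C = X"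
    using separable by (auto simp: separable_space_def)
  then have "C \<noteq> {}" using assms by auto
  then have ran: "range (from_nat_into C) = C" using C(1) by (rule range_from_nat_into)
  have "\<exists>n. d x (from_nat_into C n) < e" if "x \<in> X" "0 < e" for x e
  proof -
    have "x \<in> mtopology closure_of C" using that C(3) by simp
    then obtain y where "y \<in> C" "d x y < e"
      using \<open>0 < e\<close> unfolding metric_closure_of in_mball by blast
    then show ?thesis using ran by (metis rangeE)
  qed
  then have "\<exists>s::nat \<Rightarrow> 'a. range s \<subseteq> X \<and> (\<forall>x\<in>X. \<forall>e>0. \<exists>n. d x (s n) < e)"
    using ran C(2) by (intro exI[of _ "from_nat_into C"]) auto
  from someI_ex[OF this, folded dense_seq_def]
  show "dense_seq n \<in> X" and "\<And>x e. x \<in> X \<Longrightarrow> 0 < e \<Longrightarrow> \<exists>n. d x (dense_seq n) < e"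
    by auto
qed

text \<open>The index of the cell of a point in the countable partition of \<open>X\<close> that arises from the balls of
  radius \<open>e\<close> around the dense sequence by assigning each point to the first ball containing it.\<close>

definition cell :: "real \<Rightarrow> 'a \<Rightarrow> nat" where
  "cell e x = (LEAST n. d x (dense_seq n) < e)"

lemma dist_cell:
  assumes "x \<in> X" "0 < e"
  shows "d x (dense_seq (cell e x)) < e"
  unfolding cell_def
  by (rule LeastI_ex) (use dense_seq[of] assms in auto)

lemma open_ball_in_BX [measurable, simp]: "mball x r \<in> sets BX"
  by (intro borel_of_open openin_mball)

lemma dist_dense_seq_ball: "X \<noteq> {} \<Longrightarrow> {x\<in>X. d x (dense_seq n) < e} = mball (dense_seq n) e"
  using dense_seq(1)[of n] by (auto simp: commute)

lemma cell_measurable [measurable]: "cell e \<in> BX \<rightarrow>\<^sub>M count_space UNIV"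
proof (cases "X = {}")
  case True
  have "space BX = {}" unfolding space_borel_of topspace_mtopology by (rule True)
  then show ?thesis by (auto simp: measurable_def simp del: space_borel_of)
next
  case False
  have "(\<lambda>x. d x (dense_seq n) < e) \<in> BX \<rightarrow>\<^sub>M count_space UNIV" for n
    using False by (simp add: pred_def dist_dense_seq_ball)
  then show ?thesis
    unfolding cell_def by (rule measurable_Least)
qed

text \<open>An open subset of the product is a union of products of balls with centres in the dense
  sequence and radii \<open>1/(k+1)\<close>. There are only countably many of these.\<close>

lemma sets_BX_prod: "sets (borel_of (prod_topology mtopology mtopology)) = sets (BX \<Otimes>\<^sub>M BX)"
proof (rule antisym)
  show "sets (BX \<Otimes>\<^sub>M BX) \<subseteq> sets (borel_of (prod_topology mtopology mtopology))"
  proof -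
    have *: "fst \<in> borel_of (prod_topology mtopology mtopology) \<rightarrow>\<^sub>M BX"
      "snd \<in> borel_of (prod_topology mtopology mtopology) \<rightarrow>\<^sub>M BX"
      by (auto intro!: continuous_map_measurable continuous_map_fst continuous_map_snd)
    then have "(\<lambda>z. (fst z, snd z)) \<in> borel_of (prod_topology mtopology mtopology) \<rightarrow>\<^sub>M BX \<Otimes>\<^sub>M BX"
      by (rule measurable_Pair)
    then have id: "id \<in> borel_of (prod_topology mtopology mtopology) \<rightarrow>\<^sub>M BX \<Otimes>\<^sub>M BX"
      by (simp add: id_def)
    show ?thesis
    proof
      fix A assume A: "A \<in> sets (BX \<Otimes>\<^sub>M BX)"
      then have "A \<subseteq> X \<times> X" using sets.sets_into_space[OF A] by (simp add: space_pair_measure)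
      then show "A \<in> sets (borel_of (prod_topology mtopology mtopology))"
        using measurable_sets[OF id A] by (simp add: Int_absorb2)
    qed
  qed
  show "sets (borel_of (prod_topology mtopology mtopology)) \<subseteq> sets (BX \<Otimes>\<^sub>M BX)"
    unfolding sets_borel_of
  proof (rule sets.sigma_sets_subset')
    show "{U. openin (prod_topology mtopology mtopology) U} \<subseteq> sets (BX \<Otimes>\<^sub>M BX)"
    proof safe
      fix U assume U: "openin (prod_topology mtopology mtopology) U"
      let ?B = "\<lambda>n k. mball (dense_seq n) (inverse (real (Suc k)))"
      let ?J = "{(n,m,k). ?B n k \<times> ?B m k \<subseteq> U}"
      have "U = (\<Union>(n,m,k)\<in>?J. ?B n k \<times> ?B m k)"
      proof (intro equalityI subsetI)
        fix z assume z: "z \<in> U"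
        obtain x y where xy: "z = (x, y)" by (cases z)
        obtain V W where VW: "openin mtopology V" "openin mtopology W" "x \<in> V" "y \<in> W" "V \<times> W \<subseteq> U"
          using iffD1[OF openin_prod_topology_alt U, rule_format, of x y] z xy by auto
        then have X: "x \<in> X" "y \<in> X" using openin_subset by fastforce+
        obtain r where r: "0 < r" "mball x r \<subseteq> V"
          using iffD1[OF openin_mtopology VW(1)] VW(3) by auto
        obtain s where s: "0 < s" "mball y s \<subseteq> W"
          using iffD1[OF openin_mtopology VW(2)] VW(4) by auto
        note rs = r s
        obtain k where k: "inverse (real (Suc k)) < min r s / 2"
          using reals_Archimedean[of "min r s / 2"] rs by auto
        obtain n m where nm: "d x (dense_seq n) < inverse (real (Suc k))" "d y (dense_seq m) < inverse (real (Suc k))"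
          using dense_seq(2)[of x "inverse (real (Suc k))"] dense_seq(2)[of y "inverse (real (Suc k))"] X by auto
        have D: "dense_seq i \<in> X" for i using dense_seq(1) X by auto
        have "?B n k \<subseteq> mball x r"
          using nm(1) k D X by (intro mball_subset) (auto simp: commute)
        moreover have "?B m k \<subseteq> mball y s"
          using nm(2) k D X by (intro mball_subset) (auto simp: commute)
        ultimately have "?B n k \<times> ?B m k \<subseteq> V \<times> W"
          using rs by (intro Sigma_mono) (meson order_trans)+
        then have "(n,m,k) \<in> ?J" using VW(5) by blast
        moreover have "z \<in> ?B n k \<times> ?B m k" using nm D X xy by (simp add: commute)
        ultimately show "z \<in> (\<Union>(n,m,k)\<in>?J. ?B n k \<times> ?B m k)" by blast
      qed auto
      also have "\<dots> \<in> sets (BX \<Otimes>\<^sub>M BX)"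
        by (intro sets.countable_UN') (auto split: prod.splits)
      finally show "U \<in> sets (BX \<Otimes>\<^sub>M BX)" .
    qed
    show "topspace (prod_topology mtopology mtopology) \<in> sets (BX \<Otimes>\<^sub>M BX)"
      by (metis sets.top space_pair_measure space_borel_of topspace_prod_topology)
  qed
qed

lemma dist_measurable [measurable]: "(\<lambda>z. d (fst z) (snd z)) \<in> borel_measurable (BX \<Otimes>\<^sub>M BX)"
proof -
  have "continuous_map (prod_topology mtopology mtopology) euclidean (\<lambda>z. mdist (metric (X,d)) (fst z) (snd z))"
    by (intro continuous_map_mdist) (auto simp: mtopology_of continuous_map_fst continuous_map_snd)
  then have "(\<lambda>z. d (fst z) (snd z)) \<in> borel_measurable (borel_of (prod_topology mtopology mtopology))"
    by (intro continuous_map_borel_measurable) simp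
  then show ?thesis using sets_BX_prod by (simp cong: measurable_cong_sets)
qed

lemma space_BX_prod: "space (BX \<Otimes>\<^sub>M BX) = X \<times> X"
  by (simp add: space_pair_measure)

lemma diameter_bound: obtains D where "0 < D" "\<And>x y. x \<in> X \<Longrightarrow> y \<in> X \<Longrightarrow> d x y \<le> D"
  using bounded unfolding mbounded_alt_pos by (meson)

end

lemma bounded_polish_imp: "bounded_polish_metric_space X d \<Longrightarrow> bounded_separable_metric X d"
  by (simp add: bounded_polish_metric_space_def bounded_separable_metric_def bounded_separable_metric_axioms_def)

section \<open>The generalized Wasserstein distance as an infimum over partial plans\<close>

locale wasserstein_space = bounded_separable_metric X d for X :: "'a set" and d +
  fixes p a b :: real
  assumes p: "1 \<le> p" and a: "0 < a" and b: "0 < b"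
begin

abbreviation W :: "'a measure \<Rightarrow> 'a measure \<Rightarrow> real" where
  "W \<equiv> gen_wasserstein X d p a b"

abbreviation left :: "('a \<times> 'a) measure \<Rightarrow> 'a measure" where "left P \<equiv> distr P BX fst"
abbreviation right :: "('a \<times> 'a) measure \<Rightarrow> 'a measure" where "right P \<equiv> distr P BX snd"

text \<open>A measure on \<open>X \<times> X\<close> together with a positive bound \<open>A\<close> for the \<open>L\<^sup>p\<close> norm of the distance. Its
  marginals need not be the measures to be compared; \<open>plan_value\<close> charges for
  the difference in total variation.\<close>

definition partial_plan :: "('a \<times> 'a) measure \<Rightarrow> real \<Rightarrow> bool" where
  "partial_plan P A \<longleftrightarrow> sets P = sets (BX \<Otimes>\<^sub>M BX) \<and> finite_measure P \<and> 0 < A \<and>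
     (\<integral>\<^sup>+z. ennreal (d (fst z) (snd z) powr p) \<partial>P) \<le> ennreal (A powr p)"

definition plan_value :: "'a measure \<Rightarrow> 'a measure \<Rightarrow> ('a \<times> 'a) measure \<Rightarrow> real \<Rightarrow> real" where
  "plan_value \<mu> \<nu> P A = a * tv_mass_diff \<mu> (left P) + a * tv_mass_diff \<nu> (right P) + b * A"

text \<open>On a bounded space, the moment condition is automatic.\<close>

lemma measures_p_eq: "measures_p X d p = {\<mu>. sets \<mu> = sets BX \<and> finite_measure \<mu>}"
proof -
  obtain D where D: "0 < D" "\<And>x y. x \<in> X \<Longrightarrow> y \<in> X \<Longrightarrow> d x y \<le> D" using diameter_bound by blast
  have "(\<integral>\<^sup>+x. ennreal (d x x0 powr p) \<partial>\<mu>) < \<infinity>"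
    if "sets \<mu> = sets BX" "finite_measure \<mu>" "x0 \<in> X" for \<mu> x0
  proof -
    interpret finite_measure \<mu> by fact
    have "(\<integral>\<^sup>+x. ennreal (d x x0 powr p) \<partial>\<mu>) \<le> (\<integral>\<^sup>+x. ennreal (D powr p) \<partial>\<mu>)"
      using D p that sets_eq_imp_space_eq[OF that(1)]
      by (intro nn_integral_mono ennreal_leI powr_mono2) auto
    also have "\<dots> < \<infinity>" by (simp add: emeasure_eq_measure ennreal_mult_less_top)
    finally show ?thesis .
  qed
  then show ?thesis by (auto simp: measures_p_def finite_borel_measures_def)
qed

lemma plan_marginals:
  assumes "partial_plan P A"
  shows "sets P = sets (BX \<Otimes>\<^sub>M BX)" "space P = X \<times> X" "finite_measure P"
    "fst \<in> P \<rightarrow>\<^sub>M BX" "snd \<in> P \<rightarrow>\<^sub>M BX" "finite_measure (left P)" "finite_measure (right P)"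
    "mass (left P) = mass P" "mass (right P) = mass P"
proof -
  show s: "sets P = sets (BX \<Otimes>\<^sub>M BX)" and f: "finite_measure P"
    using assms by (auto simp: partial_plan_def)
  show sp: "space P = X \<times> X" using sets_eq_imp_space_eq[OF s] by (simp add: space_BX_prod)
  show m: "fst \<in> P \<rightarrow>\<^sub>M BX" "snd \<in> P \<rightarrow>\<^sub>M BX"
    using s by (simp_all cong: measurable_cong_sets)
  then show "finite_measure (left P)" "finite_measure (right P)"
    using f by (auto intro: finite_measure.finite_measure_distr)
  have "fst -` X \<inter> (X \<times> X) = X \<times> X" "snd -` X \<inter> (X \<times> X) = X \<times> X" by auto
  then show "mass (left P) = mass P" "mass (right P) = mass P"
    using m sets.top[of BX] by (simp_all add: mass_def measure_distr sp)
qed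

text \<open>Dividing a plan by its mass gives an admissible transport plan between its marginals. If the mass
  is zero, the Wasserstein distance vanishes because of the factor in front of the infimum.\<close>

lemma wasserstein_le:
  assumes P: "partial_plan P A"
  shows "wasserstein X d p (left P) (right P) \<le> A"
proof -
  note pm = plan_marginals[OF P]
  interpret finite_measure P by (rule pm)
  let ?m = "mass P"
  have A: "0 < A" and c: "(\<integral>\<^sup>+z. ennreal (d (fst z) (snd z) powr p) \<partial>P) \<le> ennreal (A powr p)"
    using P by (auto simp: partial_plan_def)
  have [measurable_cong]: "sets P = sets (BX \<Otimes>\<^sub>M BX)" by (rule pm)
  let ?I = "INF \<pi>\<in>transport_plans X d (left P) (right P). \<integral>\<^sup>+(x, y). ennreal (d x y powr p) \<partial>\<pi>"
  have "ennreal ?m * ?I \<le> ennreal (A powr p)"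
  proof (cases "?m = 0")
    case False
    then have m: "0 < ?m" by (simp add: mass_def zero_less_measure_iff)
    define \<pi> where "\<pi> = scale_measure (ennreal (1 / ?m)) P"
    have "emeasure \<pi> (space \<pi>) = ennreal (1 / ?m * ?m)"
      unfolding \<pi>_def using m
      by (simp add: emeasure_scale_measure space_scale_measure emeasure_eq_measure mass_def ennreal_mult[symmetric])
    then have "prob_space \<pi>" using m by (intro prob_spaceI) simp
    moreover have "fst -` B \<inter> (X \<times> X) = B \<times> X" "snd -` B \<inter> (X \<times> X) = X \<times> B" if "B \<in> sets BX" for B
      using sets.sets_into_space[OF that] by auto
    ultimately have "\<pi> \<in> transport_plans X d (left P) (right P)"
      using m pm by (auto simp: transport_plans_def \<pi>_def sets_BX_prod measure_scale_measure measure_distr)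
    then have "ennreal ?m * ?I \<le> ennreal ?m * (\<integral>\<^sup>+(x, y). ennreal (d x y powr p) \<partial>\<pi>)"
      by (intro mult_left_mono INF_lower) auto
    also have "\<dots> = ennreal ?m * (ennreal (1 / ?m) * (\<integral>\<^sup>+z. ennreal (d (fst z) (snd z) powr p) \<partial>P))"
      unfolding \<pi>_def case_prod_beta by (subst nn_integral_scale_measure) auto
    also have "\<dots> = (\<integral>\<^sup>+z. ennreal (d (fst z) (snd z) powr p) \<partial>P)"
      using m by (simp add: mult.assoc[symmetric] ennreal_mult[symmetric])
    finally show ?thesis using c by simp
  qed simp
  then have "enn2real (ennreal ?m * ?I) \<le> A powr p"
    by (intro enn2real_leI) auto
  then have "enn2real (ennreal ?m * ?I) powr (1 / p) \<le> (A powr p) powr (1 / p)"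
    using p by (intro powr_mono2) auto
  then show ?thesis
    unfolding wasserstein_def pm using A p by (simp add: powr_powr)
qed

lemma W_set_nonneg:
  "x \<in> {a * tv_mass_diff \<mu> \<mu>' + a * tv_mass_diff \<nu> \<nu>' + b * wasserstein X d p \<mu>' \<nu>' | \<mu>' \<nu>'.
            \<mu>' \<in> measures_p X d p \<and> \<nu>' \<in> measures_p X d p \<and> mass \<mu>' = mass \<nu>'} \<Longrightarrow> 0 \<le> x"
  using a b by (auto simp: wasserstein_def)

lemma W_set_nonempty:
  "{a * tv_mass_diff \<mu> \<mu>' + a * tv_mass_diff \<nu> \<nu>' + b * wasserstein X d p \<mu>' \<nu>' | \<mu>' \<nu>'.
            \<mu>' \<in> measures_p X d p \<and> \<nu>' \<in> measures_p X d p \<and> mass \<mu>' = mass \<nu>'} \<noteq> {}"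
proof -
  have "null_measure BX \<in> measures_p X d p"
    by (auto simp: measures_p_eq intro!: finite_measureI)
  then show ?thesis by blast
qed

lemma W_nonneg: "0 \<le> W \<mu> \<nu>"
  unfolding gen_wasserstein_def by (rule cInf_greatest[OF W_set_nonempty W_set_nonneg])

text \<open>This and \<open>W_less_obtain_plan\<close> together say that \<open>W\<close> is the infimum of the plan
  values. From here on, all estimates of \<open>W\<close> are derived from these two facts and nonnegativity.\<close>

lemma W_le_plan_value:
  assumes P: "partial_plan P A"
  shows "W \<mu> \<nu> \<le> plan_value \<mu> \<nu> P A"
proof -
  note pm = plan_marginals[OF P]
  have "W \<mu> \<nu> \<le> a * tv_mass_diff \<mu> (left P) + a * tv_mass_diff \<nu> (right P) + b * wasserstein X d p (left P) (right P)"
    unfolding gen_wasserstein_def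
  proof (rule cInf_lower)
    show "bdd_below {a * tv_mass_diff \<mu> \<mu>' + a * tv_mass_diff \<nu> \<nu>' + b * wasserstein X d p \<mu>' \<nu>' | \<mu>' \<nu>'.
            \<mu>' \<in> measures_p X d p \<and> \<nu>' \<in> measures_p X d p \<and> mass \<mu>' = mass \<nu>'}"
      by (rule bdd_belowI, rule W_set_nonneg)
    show "a * tv_mass_diff \<mu> (left P) + a * tv_mass_diff \<nu> (right P) + b * wasserstein X d p (left P) (right P)
      \<in> {a * tv_mass_diff \<mu> \<mu>' + a * tv_mass_diff \<nu> \<nu>' + b * wasserstein X d p \<mu>' \<nu>' | \<mu>' \<nu>'.
            \<mu>' \<in> measures_p X d p \<and> \<nu>' \<in> measures_p X d p \<and> mass \<mu>' = mass \<nu>'}"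
      by (intro CollectI exI[of _ "left P"] exI[of _ "right P"]) (use pm in \<open>auto simp: measures_p_eq\<close>)
  qed
  also have "\<dots> \<le> plan_value \<mu> \<nu> P A"
    unfolding plan_value_def using b wasserstein_le[OF P] by simp
  finally show ?thesis .
qed

text \<open>Transport plans exist, so the infimum in the Wasserstein distance is not the infimum of the empty set,
  which would be infinite and then be turned into zero.\<close>

lemma product_plan:
  assumes "sets \<mu> = sets BX" "finite_measure \<mu>" "sets \<nu> = sets BX" "finite_measure \<nu>"
    and m: "mass \<mu> = mass \<nu>" "0 < mass \<mu>"
  shows "scale_measure (ennreal (1 / (mass \<mu> * mass \<mu>))) (\<mu> \<Otimes>\<^sub>M \<nu>) \<in> transport_plans X d \<mu> \<nu>"
proof -
  interpret M: finite_measure \<mu> by fact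
  interpret N: finite_measure \<nu> by fact
  interpret pair_sigma_finite \<mu> \<nu> ..
  let ?P = "scale_measure (ennreal (1 / (mass \<mu> * mass \<mu>))) (\<mu> \<Otimes>\<^sub>M \<nu>)"
  have sp: "space \<mu> = X" "space \<nu> = X" using assms(1,3)[THEN sets_eq_imp_space_eq] by auto
  have Xs: "X \<in> sets \<mu>" "X \<in> sets \<nu>" using sets.top[of \<mu>] sets.top[of \<nu>] by (simp_all add: sp)
  have rect: "measure ?P (A \<times> B) = measure \<mu> A * measure \<nu> B / (mass \<mu> * mass \<mu>)"
    if "A \<in> sets \<mu>" "B \<in> sets \<nu>" for A B
  proof -
    have "emeasure (\<mu> \<Otimes>\<^sub>M \<nu>) (A \<times> B) = ennreal (measure \<mu> A * measure \<nu> B)"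
      using that by (simp add: N.emeasure_pair_measure_Times M.emeasure_eq_measure N.emeasure_eq_measure ennreal_mult)
    then have "measure (\<mu> \<Otimes>\<^sub>M \<nu>) (A \<times> B) = measure \<mu> A * measure \<nu> B"
      by (rule measure_eq_emeasure_eq_ennreal[rotated]) simp
    then show ?thesis using m by (simp add: measure_scale_measure)
  qed
  have eP: "emeasure ?P (space ?P) = 1"
  proof -
    have "emeasure ?P (space ?P) = ennreal (1 / (mass \<mu> * mass \<mu>)) * (ennreal (mass \<mu>) * ennreal (mass \<nu>))"
      by (simp add: emeasure_scale_measure space_scale_measure space_pair_measure N.emeasure_pair_measure_Times
          M.emeasure_eq_measure N.emeasure_eq_measure mass_def)
    also have "\<dots> = 1" using m by (simp add: ennreal_mult[symmetric])
    finally show ?thesis .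
  qed
  have "sets (\<mu> \<Otimes>\<^sub>M \<nu>) = sets (BX \<Otimes>\<^sub>M BX)" using assms by (intro sets_pair_measure_cong)
  then show ?thesis
    unfolding transport_plans_def
    using eP rect Xs assms(1,3) m by (auto simp: sets_BX_prod prob_spaceI mass_def sp)
qed

text \<open>For measures of positive mass, a nearly optimal transport plan is rescaled; for zero measures the zero plan
  serves.\<close>

lemma coupling_of_wasserstein:
  assumes mu: "sets \<mu> = sets BX" "finite_measure \<mu>" and nu: "sets \<nu> = sets BX" "finite_measure \<nu>"
    and m: "mass \<mu> = mass \<nu>" and r: "wasserstein X d p \<mu> \<nu> < r"
  shows "\<exists>P. partial_plan P r \<and> left P = \<mu> \<and> right P = \<nu>"
proof (cases "mass \<mu> = 0")
  case True
  let ?P = "null_measure (BX \<Otimes>\<^sub>M BX)"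
  have r0: "0 < r" using r True by (simp add: wasserstein_def)
  have P: "partial_plan ?P r"
    using r0 by (auto simp: partial_plan_def intro!: finite_measureI)
  have *: "distr ?P BX f = \<rho>" if "sets \<rho> = sets BX" "finite_measure \<rho>" "mass \<rho> = 0" "f \<in> BX \<Otimes>\<^sub>M BX \<rightarrow>\<^sub>M BX" for f \<rho>
  proof (rule measure_eqI)
    interpret finite_measure \<rho> by fact
    fix A assume "A \<in> sets (distr ?P BX f)"
    have "measure \<rho> A \<le> 0" using bounded_measure[of A] that(3) by (simp add: mass_def)
    then have "emeasure \<rho> A = 0" by (simp add: emeasure_eq_measure measure_le_0_iff)
    moreover have "f \<in> ?P \<rightarrow>\<^sub>M BX" using that(4) by (simp cong: measurable_cong_sets)
    ultimately show "emeasure (distr ?P BX f) A = emeasure \<rho> A"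
      using \<open>A \<in> _\<close> by (simp add: emeasure_distr)
  qed (simp add: that)
  show ?thesis using P *[OF mu True measurable_fst] *[OF nu _ measurable_snd] True m by metis
next
  case False
  then have m0: "0 < mass \<mu>" by (simp add: mass_def zero_less_measure_iff)
  let ?I = "INF \<pi>\<in>transport_plans X d \<mu> \<nu>. \<integral>\<^sup>+(x, y). ennreal (d x y powr p) \<partial>\<pi>"
  have r0: "0 < r" using r by (rule le_less_trans[rotated]) (simp add: wasserstein_def)
  obtain D where D: "0 < D" "\<And>x y. x \<in> X \<Longrightarrow> y \<in> X \<Longrightarrow> d x y \<le> D" using diameter_bound by blast
  have pl: "sets \<pi> = sets (BX \<Otimes>\<^sub>M BX)" "space \<pi> = X \<times> X" "prob_space \<pi>" if "\<pi> \<in> transport_plans X d \<mu> \<nu>" for \<pi>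
  proof -
    show s: "sets \<pi> = sets (BX \<Otimes>\<^sub>M BX)" "prob_space \<pi>"
      using that by (auto simp: transport_plans_def sets_BX_prod)
    show "space \<pi> = X \<times> X" using sets_eq_imp_space_eq[OF s(1)] by (simp add: space_BX_prod)
  qed
  define \<pi>0 where "\<pi>0 = scale_measure (ennreal (1 / (mass \<mu> * mass \<mu>))) (\<mu> \<Otimes>\<^sub>M \<nu>)"
  have pi0: "\<pi>0 \<in> transport_plans X d \<mu> \<nu>"
    unfolding \<pi>0_def by (rule product_plan[OF mu nu m m0])
  \<comment> \<open>Finiteness of the infimum, from boundedness of the metric.\<close>
  have "?I \<le> (\<integral>\<^sup>+(x, y). ennreal (d x y powr p) \<partial>\<pi>0)" using pi0 by (rule INF_lower)
  also have "\<dots> \<le> (\<integral>\<^sup>+z. ennreal (D powr p) \<partial>\<pi>0)"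
    using D p pl(2)[OF pi0] by (intro nn_integral_mono) (auto intro!: ennreal_leI powr_mono2)
  also have "\<dots> < top_class.top"
    using prob_space.emeasure_space_1[OF pl(3)[OF pi0]] by simp
  finally have fin: "?I < top_class.top" .
  have "enn2real (ennreal (mass \<mu>) * ?I) < r powr p"
  proof (rule ccontr)
    assume "\<not> ?thesis"
    then have "(r powr p) powr (1/p) \<le> enn2real (ennreal (mass \<mu>) * ?I) powr (1/p)"
      using p by (intro powr_mono2) auto
    then show False using r r0 p by (simp add: wasserstein_def powr_powr)
  qed
  then have "ennreal (mass \<mu>) * ?I < ennreal (r powr p)"
    using fin by (subst (asm) enn2real_less_iff) (auto simp: ennreal_mult_less_top)
  then have "?I < ennreal (r powr p / mass \<mu>)"
  proof (rule contrapos_pp)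
    assume "\<not> ?I < ennreal (r powr p / mass \<mu>)"
    then have "ennreal (mass \<mu>) * ennreal (r powr p / mass \<mu>) \<le> ennreal (mass \<mu>) * ?I"
      by (intro mult_left_mono) auto
    then show "\<not> ennreal (mass \<mu>) * ?I < ennreal (r powr p)"
      using m0 by (simp add: ennreal_mult[symmetric])
  qed
  then obtain \<pi> where \<pi>: "\<pi> \<in> transport_plans X d \<mu> \<nu>"
      and c: "(\<integral>\<^sup>+(x, y). ennreal (d x y powr p) \<partial>\<pi>) < ennreal (r powr p / mass \<mu>)"
    unfolding INF_less_iff by blast
  note [measurable_cong] = pl(1)[OF \<pi>]
  interpret prob_space \<pi> by (rule pl(3)[OF \<pi>])
  define P where "P = scale_measure (ennreal (mass \<mu>)) \<pi>"
  have "(\<integral>\<^sup>+z. ennreal (d (fst z) (snd z) powr p) \<partial>P) = ennreal (mass \<mu>) * (\<integral>\<^sup>+(x, y). ennreal (d x y powr p) \<partial>\<pi>)"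
    unfolding P_def case_prod_beta by (subst nn_integral_scale_measure) auto
  also have "\<dots> \<le> ennreal (mass \<mu>) * ennreal (r powr p / mass \<mu>)"
    using c by (intro mult_left_mono) auto
  also have "\<dots> = ennreal (r powr p)" using m0 by (simp add: ennreal_mult[symmetric])
  finally have cost: "(\<integral>\<^sup>+z. ennreal (d (fst z) (snd z) powr p) \<partial>P) \<le> ennreal (r powr p)" .
  have fP: "finite_measure P"
    unfolding P_def by (rule finite_measureI) (simp add: emeasure_scale_measure space_scale_measure emeasure_space_1)
  interpret P: finite_measure P by (rule fP)
  have sP: "sets P = sets (BX \<Otimes>\<^sub>M BX)" by (simp add: P_def pl(1)[OF \<pi>])
  have P: "partial_plan P r" using fP sP cost r0 by (simp add: partial_plan_def)
  note pm = plan_marginals[OF P]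
  have pre: "fst -` B \<inter> (X \<times> X) = B \<times> X" "snd -` B \<inter> (X \<times> X) = X \<times> B" if "B \<in> sets BX" for B
    using sets.sets_into_space[OF that] by auto
  have marg: "mass \<mu> * measure \<pi> (B \<times> X) = measure \<mu> B" "mass \<mu> * measure \<pi> (X \<times> B) = measure \<nu> B" if "B \<in> sets BX" for B
    using \<pi> that m by (auto simp: transport_plans_def)
  have "left P = \<mu>"
  proof (rule measure_eqI)
    fix B assume "B \<in> sets (left P)"
    then have B: "B \<in> sets BX" by simp
    have "emeasure (left P) B = ennreal (measure P (B \<times> X))"
      using B pm by (simp add: emeasure_distr pre P.emeasure_eq_measure)
    also have "measure P (B \<times> X) = measure \<mu> B"
      using marg(1)[OF B] m0 by (simp add: P_def measure_scale_measure)
    finally show "emeasure (left P) B = emeasure \<mu> B"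
      using mu(2) by (simp add: finite_measure.emeasure_eq_measure)
  qed (simp add: mu)
  moreover have "right P = \<nu>"
  proof (rule measure_eqI)
    fix B assume "B \<in> sets (right P)"
    then have B: "B \<in> sets BX" by simp
    have "emeasure (right P) B = ennreal (measure P (X \<times> B))"
      using B pm by (simp add: emeasure_distr pre P.emeasure_eq_measure)
    also have "measure P (X \<times> B) = measure \<nu> B"
      using marg(2)[OF B] m0 by (simp add: P_def measure_scale_measure)
    finally show "emeasure (right P) B = emeasure \<nu> B"
      using nu(2) by (simp add: finite_measure.emeasure_eq_measure)
  qed (simp add: nu)
  ultimately show ?thesis using P by blast
qed

lemma W_less_obtain_plan:
  assumes "W \<mu> \<nu> < r"
  obtains P A where "partial_plan P A" "plan_value \<mu> \<nu> P A < r"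
proof -
  let ?S = "{a * tv_mass_diff \<mu> \<mu>' + a * tv_mass_diff \<nu> \<nu>' + b * wasserstein X d p \<mu>' \<nu>' | \<mu>' \<nu>'.
            \<mu>' \<in> measures_p X d p \<and> \<nu>' \<in> measures_p X d p \<and> mass \<mu>' = mass \<nu>'}"
  obtain x where "x \<in> ?S" "x < r"
    using cInf_lessD[OF W_set_nonempty assms[unfolded gen_wasserstein_def]] by blast
  then obtain \<mu>' \<nu>' where s: "sets \<mu>' = sets BX" "finite_measure \<mu>'" "sets \<nu>' = sets BX" "finite_measure \<nu>'"
      and m: "mass \<mu>' = mass \<nu>'"
      and less: "a * tv_mass_diff \<mu> \<mu>' + a * tv_mass_diff \<nu> \<nu>' + b * wasserstein X d p \<mu>' \<nu>' < r"
    by (auto simp: measures_p_eq)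
  define S where "S = a * tv_mass_diff \<mu> \<mu>' + a * tv_mass_diff \<nu> \<nu>' + b * wasserstein X d p \<mu>' \<nu>'"
  \<comment> \<open>Half of the slack \<open>r - S\<close> pays for a plan that is only nearly optimal.\<close>
  define A where "A = wasserstein X d p \<mu>' \<nu>' + (r - S) / (2 * b)"
  have Sr: "S < r" using less by (simp add: S_def)
  have bA: "b * A = b * wasserstein X d p \<mu>' \<nu>' + (r - S) / 2"
    using b by (simp add: A_def distrib_left)
  have 1: "wasserstein X d p \<mu>' \<nu>' < A" using Sr b by (simp add: A_def)
  have 2: "a * tv_mass_diff \<mu> \<mu>' + a * tv_mass_diff \<nu> \<nu>' + b * A < r"
  proof -
    have "a * tv_mass_diff \<mu> \<mu>' + a * tv_mass_diff \<nu> \<nu>' + b * A = S + (r - S) / 2"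
      unfolding bA by (simp add: S_def)
    then show ?thesis using Sr by (simp add: field_simps)
  qed
  obtain P where "partial_plan P A" "left P = \<mu>'" "right P = \<nu>'"
    using coupling_of_wasserstein[OF s m 1] by blast
  then show thesis using 2 that by (simp add: plan_value_def)
qed

end

section \<open>Push-forwards\<close>

context wasserstein_space
begin

lemma partial_planI:
  assumes "sets P = sets (BX \<Otimes>\<^sub>M BX)" "finite_measure P" "0 < A"
    "(\<integral>\<^sup>+z. ennreal (d (fst z) (snd z) powr p) \<partial>P) \<le> ennreal (A powr p)"
  shows "partial_plan P A"
  using assms by (simp add: partial_plan_def)

lemma partial_planD:
  assumes "partial_plan P A"
  shows "sets P = sets (BX \<Otimes>\<^sub>M BX)" "finite_measure P" "0 < A"
    "(\<integral>\<^sup>+z. ennreal (d (fst z) (snd z) powr p) \<partial>P) \<le> ennreal (A powr p)"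
  using assms by (auto simp: partial_plan_def)

text \<open>Exchanging the two coordinates of a plan exchanges its marginals and preserves its cost.\<close>

lemma W_commute_le: "W \<nu> \<mu> \<le> W \<mu> \<nu>"
proof (rule field_le_epsilon)
  fix t :: real assume "0 < t"
  then obtain P A where P: "partial_plan P A" and v: "plan_value \<mu> \<nu> P A < W \<mu> \<nu> + t"
    using W_less_obtain_plan[of \<mu> \<nu> "W \<mu> \<nu> + t"] by auto
  note [measurable_cong] = plan_marginals(1)[OF P]
  note [measurable] = plan_marginals(4,5)[OF P]
  define Q where "Q = distr P (BX \<Otimes>\<^sub>M BX) (\<lambda>z. (snd z, fst z))"
  have m: "(\<lambda>z. (snd z, fst z)) \<in> P \<rightarrow>\<^sub>M BX \<Otimes>\<^sub>M BX" by measurable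
  have "(\<integral>\<^sup>+z. ennreal (d (fst z) (snd z) powr p) \<partial>Q) = (\<integral>\<^sup>+z. ennreal (d (fst z) (snd z) powr p) \<partial>P)"
    unfolding Q_def by (subst nn_integral_distr[OF m]) (auto simp: commute)
  then have Q: "partial_plan Q A"
    using partial_planD[OF P] finite_measure.finite_measure_distr[OF partial_planD(2)[OF P] m]
    by (intro partial_planI) (auto simp: Q_def)
  have "left Q = right P" "right Q = left P"
    unfolding Q_def by (auto simp: distr_distr comp_def)
  then have "W \<nu> \<mu> \<le> plan_value \<mu> \<nu> P A"
    using W_le_plan_value[OF Q, of \<nu> \<mu>] by (simp add: plan_value_def)
  then show "W \<nu> \<mu> \<le> W \<mu> \<nu> + t" using v by simp
qed

lemma W_commute: "W \<mu> \<nu> = W \<nu> \<mu>"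
  using W_commute_le by (intro antisym)

text \<open>The value of the zero plan.\<close>

lemma W_le_masses:
  assumes mu: "sets \<mu> = sets BX" "finite_measure \<mu>" and nu: "sets \<nu> = sets BX" "finite_measure \<nu>"
  shows "W \<mu> \<nu> \<le> a * mass \<mu> + a * mass \<nu>"
proof (rule field_le_epsilon)
  fix t :: real assume t: "0 < t"
  let ?P = "null_measure (BX \<Otimes>\<^sub>M BX)"
  have P: "partial_plan ?P (t / b)"
    using t b by (intro partial_planI) (auto intro!: finite_measureI)
  have "tv_mass_diff \<rho> (distr ?P BX f) \<le> mass \<rho>"
    if r: "sets \<rho> = sets BX" "finite_measure \<rho>" and f: "f \<in> ?P \<rightarrow>\<^sub>M BX" for \<rho> f
  proof -
    have 0: "measure (distr ?P BX f) A = 0" if "A \<in> sets BX" for A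
      using that by (simp add: emeasure_distr[OF f] measure_def)
    have fin: "finite_measure (distr ?P BX f)"
      by (rule finite_measure.finite_measure_distr[OF _ f]) (auto intro!: finite_measureI)
    have "tv_mass_diff \<rho> (distr ?P BX f) \<le> mass \<rho> - mass (distr ?P BX f)"
      using r fin 0 by (intro tv_mass_diff_dominated) auto
    then show ?thesis using 0[OF sets.top] by (simp add: mass_def)
  qed
  from this[OF mu plan_marginals(4)[OF P]] this[OF nu plan_marginals(5)[OF P]]
  have "plan_value \<mu> \<nu> ?P (t / b) \<le> a * mass \<mu> + a * mass \<nu> + t"
    unfolding plan_value_def using a b by (intro add_mono mult_left_mono) auto
  then show "W \<mu> \<nu> \<le> a * mass \<mu> + a * mass \<nu> + t"
    using W_le_plan_value[OF P, of \<mu> \<nu>] by simp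
qed

text \<open>The image of \<open>M\<close> under \<open>x \<mapsto> (F x, H x)\<close> is a plan with the two push-forwards as marginals.\<close>

lemma W_distr_close:
  assumes M: "finite_measure M" "mass M \<le> C"
    and F: "F \<in> M \<rightarrow>\<^sub>M BX" and H: "H \<in> M \<rightarrow>\<^sub>M BX"
    and close: "\<And>x. x \<in> space M \<Longrightarrow> d (F x) (H x) \<le> \<eta>" and "0 < \<eta>" "0 < C"
  shows "W (distr M BX F) (distr M BX H) \<le> b * (C powr (1 / p) * \<eta>)"
proof -
  note [measurable] = F H
  define P where "P = distr M (BX \<Otimes>\<^sub>M BX) (\<lambda>x. (F x, H x))"
  have m: "(\<lambda>x. (F x, H x)) \<in> M \<rightarrow>\<^sub>M BX \<Otimes>\<^sub>M BX" by measurable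
  have "(\<integral>\<^sup>+z. ennreal (d (fst z) (snd z) powr p) \<partial>P) = (\<integral>\<^sup>+x. ennreal (d (F x) (H x) powr p) \<partial>M)"
    unfolding P_def by (subst nn_integral_distr[OF m]) auto
  also have "\<dots> \<le> (\<integral>\<^sup>+x. ennreal (\<eta> powr p) \<partial>M)"
    using close p by (intro nn_integral_mono ennreal_leI powr_mono2) auto
  also have "\<dots> \<le> ennreal ((C powr (1 / p) * \<eta>) powr p)"
    using assms p by (intro nn_integral_const_powr_le) auto
  finally have P: "partial_plan P (C powr (1 / p) * \<eta>)"
    using assms finite_measure.finite_measure_distr[OF M(1) m]
    by (intro partial_planI) (auto simp: P_def)
  have "left P = distr M BX F" "right P = distr M BX H"
    unfolding P_def by (auto simp: distr_distr comp_def)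
  then show ?thesis
    using W_le_plan_value[OF P, of "distr M BX F" "distr M BX H"] by (simp add: plan_value_def)
qed

lemma W_self:
  assumes mu: "sets \<mu> = sets BX" "finite_measure \<mu>"
  shows "W \<mu> \<mu> = 0"
proof (rule antisym[OF _ W_nonneg], rule field_le_epsilon)
  fix t :: real assume t: "0 < t"
  let ?C = "mass \<mu> + 1"
  have C: "0 < ?C" by (simp add: mass_def add_nonneg_pos)
  have id: "(\<lambda>x. x) \<in> \<mu> \<rightarrow>\<^sub>M BX" using mu by (simp cong: measurable_cong_sets)
  have "distr \<mu> BX (\<lambda>x. x) = \<mu>" using mu by (intro distr_id2) auto
  moreover have "W (distr \<mu> BX (\<lambda>x. x)) (distr \<mu> BX (\<lambda>x. x)) \<le> b * (?C powr (1 / p) * (t / (b * ?C powr (1/p))))"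
    using C t b mu sets_eq_imp_space_eq[OF mu(1)] by (intro W_distr_close id) auto
  ultimately show "W \<mu> \<mu> \<le> 0 + t" using C b by simp
qed

text \<open>The total variation term of a plan controls its mass. This bounds the effect of a
  uniform perturbation of the distance on the cost of the plan.\<close>

lemma mass_le_plan_value:
  assumes "sets \<mu> = sets BX" "finite_measure \<mu>" and P: "partial_plan P A"
    and v: "plan_value \<mu> \<nu> P A \<le> r"
  shows "mass P \<le> mass \<mu> + r / a"
proof -
  note pm = plan_marginals[OF P]
  have "\<bar>measure \<mu> X - measure (left P) X\<bar> \<le> tv_mass_diff \<mu> (left P)"
    using assms pm sets.top[of BX] by (intro tv_mass_diff_ge_single) auto
  then have "mass P \<le> mass \<mu> + tv_mass_diff \<mu> (left P)"
    using pm(8) sets_eq_imp_space_eq[OF assms(1)] by (auto simp: mass_def)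
  moreover have "a * tv_mass_diff \<mu> (left P) \<le> plan_value \<mu> \<nu> P A"
    using a b partial_planD(3)[OF P] by (simp add: plan_value_def)
  then have "tv_mass_diff \<mu> (left P) \<le> r / a"
    using v a by (simp add: field_simps)
  ultimately show ?thesis by simp
qed

end

text \<open>The image of a nearly optimal plan under \<open>f \<times> f\<close> has marginals \<open>f\<^sub>\<sharp>P\<^sub>1\<close> and \<open>f\<^sub>\<sharp>P\<^sub>2\<close>, which are no further
  from \<open>f\<^sub>\<sharp>\<mu>\<close> and \<open>f\<^sub>\<sharp>\<nu>\<close> in total variation than before. By Minkowski's inequality the
  \<open>L\<^sup>p\<close> norm of the distance grows by at most \<open>\<eta>\<close> times the \<open>p\<close>-th root of the mass of the plan. As
  \<open>W(\<mu>, \<nu>) \<le> 2aC\<close>, a plan of value at most \<open>W(\<mu>, \<nu>) + a\<close> has mass at most \<open>3C + 1\<close>.\<close>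

lemma W_distr_le:
  assumes S: "wasserstein_space X d p a b" and T: "wasserstein_space Y e p a b"
    and f: "f \<in> metric_borel X d \<rightarrow>\<^sub>M metric_borel Y e"
    and dist: "\<And>x x'. x \<in> X \<Longrightarrow> x' \<in> X \<Longrightarrow> e (f x) (f x') \<le> d x x' + \<eta>"
    and eta: "0 < \<eta>"
    and mu: "sets \<mu> = sets (metric_borel X d)" "finite_measure \<mu>" "mass \<mu> \<le> C"
    and nu: "sets \<nu> = sets (metric_borel X d)" "finite_measure \<nu>" "mass \<nu> \<le> C"
  shows "gen_wasserstein Y e p a b (distr \<mu> (metric_borel Y e) f) (distr \<nu> (metric_borel Y e) f)
    \<le> gen_wasserstein X d p a b \<mu> \<nu> + b * ((3 * C + 1) powr (1 / p) * \<eta>)"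
proof -
  interpret S: wasserstein_space X d p a b by (rule S)
  interpret T: wasserstein_space Y e p a b by (rule T)
  note p = S.p and a = S.a and b = S.b
  note [measurable] = f
  let ?K = "(3 * C + 1) powr (1 / p)"
  have C0: "0 \<le> C" using mu(3) measure_nonneg[of \<mu> "space \<mu>"] unfolding mass_def by linarith
  have Wb: "S.W \<mu> \<nu> \<le> 2 * (a * C)"
    using S.W_le_masses[OF mu(1,2) nu(1,2)] mult_left_mono[OF mu(3), of a] mult_left_mono[OF nu(3), of a] a by linarith
  show ?thesis
  proof (rule field_le_epsilon)
    fix t :: real assume t: "0 < t"
    \<comment> \<open>The slack is at most \<open>a\<close>, so that the mass of the plan is at most \<open>3C + 1\<close>.\<close>
    define s where "s = min t a"
    have s: "0 < s" "s \<le> t" "s \<le> a" using t a by (auto simp: s_def)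
    obtain P A where P: "S.partial_plan P A" and v: "S.plan_value \<mu> \<nu> P A < S.W \<mu> \<nu> + s"
      using S.W_less_obtain_plan[of \<mu> \<nu> "S.W \<mu> \<nu> + s"] s by auto
    note pm = S.plan_marginals[OF P] and pD = S.partial_planD[OF P]
    note [measurable_cong] = pm(1)
    have "mass P \<le> mass \<mu> + (2 * (a * C) + a) / a"
      using v Wb s by (intro S.mass_le_plan_value[OF mu(1,2) P, of \<nu>]) simp
    then have mP: "mass P \<le> 3 * C + 1"
      using mu(3) a by (simp add: add_divide_distrib)
    define Q where "Q = distr P (T.BX \<Otimes>\<^sub>M T.BX) (\<lambda>z. (f (fst z), f (snd z)))"
    have m: "(\<lambda>z. (f (fst z), f (snd z))) \<in> P \<rightarrow>\<^sub>M T.BX \<Otimes>\<^sub>M T.BX" by measurable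
    have "(\<integral>\<^sup>+z. ennreal (e (fst z) (snd z) powr p) \<partial>Q) = (\<integral>\<^sup>+z. ennreal (e (f (fst z)) (f (snd z)) powr p) \<partial>P)"
      unfolding Q_def by (subst nn_integral_distr[OF m]) auto
    also have "\<dots> \<le> ennreal ((A + ?K * \<eta>) powr p)"
    proof (rule Minkowski_nn_integral[OF p pD(3), where f = "\<lambda>z. d (fst z) (snd z)" and g = "\<lambda>_. \<eta>"])
      show "(\<integral>\<^sup>+ x. ennreal (\<eta> powr p) \<partial>P) \<le> ennreal ((?K * \<eta>) powr p)"
        using pD(2) p eta mP by (intro nn_integral_const_powr_le) auto
      show "AE z in P. 0 \<le> e (f (fst z)) (f (snd z)) \<and> e (f (fst z)) (f (snd z)) \<le> d (fst z) (snd z) + \<eta>"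
        using dist pm(2) by (intro AE_I2) auto
    qed (use eta C0 pD in auto)
    finally have Q: "T.partial_plan Q (A + ?K * \<eta>)"
      using pD(2,3) eta C0 finite_measure.finite_measure_distr[OF pD(2) m]
      by (intro T.partial_planI) (auto simp: Q_def intro!: add_pos_nonneg)
    have lr: "T.left Q = distr (S.left P) T.BX f" "T.right Q = distr (S.right P) T.BX f"
      unfolding Q_def by (auto simp: distr_distr comp_def)
    have fm: "f \<in> \<rho> \<rightarrow>\<^sub>M T.BX" if "sets \<rho> = sets S.BX" for \<rho>
      using f that by (simp cong: measurable_cong_sets)
    have tv: "tv_mass_diff (distr \<mu> T.BX f) (T.left Q) \<le> tv_mass_diff \<mu> (S.left P)"
      "tv_mass_diff (distr \<nu> T.BX f) (T.right Q) \<le> tv_mass_diff \<nu> (S.right P)"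
      unfolding lr by (rule tv_mass_diff_distr; simp add: mu nu pm(6,7) fm)+
    have "T.W (distr \<mu> T.BX f) (distr \<nu> T.BX f) \<le> T.plan_value (distr \<mu> T.BX f) (distr \<nu> T.BX f) Q (A + ?K * \<eta>)"
      by (rule T.W_le_plan_value[OF Q])
    also have "\<dots> \<le> S.plan_value \<mu> \<nu> P A + b * (?K * \<eta>)"
      unfolding S.plan_value_def T.plan_value_def
      unfolding distrib_left
      using mult_left_mono[OF tv(1), of a] mult_left_mono[OF tv(2), of a] a by linarith
    finally show "T.W (distr \<mu> T.BX f) (distr \<nu> T.BX f) \<le> S.W \<mu> \<nu> + b * (?K * \<eta>) + t"
      using v s by simp
  qed
qed

section \<open>Gluing and the triangle inequality\<close>

lemma sums_measure_index:
  fixes j :: "'a \<Rightarrow> nat" and k :: "'b \<Rightarrow> nat"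
  assumes "finite_measure M" "j \<in> M \<rightarrow>\<^sub>M count_space UNIV"
  shows "(\<lambda>i. measure M {x\<in>space M. j x = i}) sums mass M"
proof -
  interpret finite_measure M by fact
  note [measurable] = assms(2)
  have "(\<lambda>i. measure M {x\<in>space M. j x = i}) sums measure M (\<Union>i. {x\<in>space M. j x = i})"
    by (intro finite_measure_UNION) (auto simp: disjoint_family_on_def)
  also have "(\<Union>i. {x\<in>space M. j x = i}) = space M" by auto
  finally show ?thesis by (simp add: mass_def)
qed

lemma nn_integral_prod_fst_le:
  assumes "finite_measure M" "finite_measure N"
    and [measurable]: "w \<in> borel_measurable (M \<Otimes>\<^sub>M N)" "g \<in> borel_measurable M"
    and w: "\<And>x. x \<in> space M \<Longrightarrow> (\<integral>\<^sup>+y. w (x, y) \<partial>N) \<le> 1"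
  shows "(\<integral>\<^sup>+z. g (fst z) \<partial>density (M \<Otimes>\<^sub>M N) w) \<le> (\<integral>\<^sup>+x. g x \<partial>M)"
proof -
  interpret M: finite_measure M by fact
  interpret N: finite_measure N by fact
  have "(\<integral>\<^sup>+z. g (fst z) \<partial>density (M \<Otimes>\<^sub>M N) w) = (\<integral>\<^sup>+z. w z * g (fst z) \<partial>(M \<Otimes>\<^sub>M N))"
    by (subst nn_integral_density) auto
  also have "\<dots> = (\<integral>\<^sup>+x. \<integral>\<^sup>+y. w (x, y) * g x \<partial>N \<partial>M)"
    by (subst N.nn_integral_fst[symmetric]) auto
  also have "\<dots> = (\<integral>\<^sup>+x. (\<integral>\<^sup>+y. w (x, y) \<partial>N) * g x \<partial>M)"
    by (intro nn_integral_cong nn_integral_multc) auto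
  also have "\<dots> \<le> (\<integral>\<^sup>+x. 1 * g x \<partial>M)"
    by (intro nn_integral_mono mult_right_mono w) auto
  finally show ?thesis by simp
qed

lemma nn_integral_prod_snd_le:
  assumes "finite_measure M" "finite_measure N"
    and [measurable]: "w \<in> borel_measurable (M \<Otimes>\<^sub>M N)" "g \<in> borel_measurable N"
    and w: "\<And>y. y \<in> space N \<Longrightarrow> (\<integral>\<^sup>+x. w (x, y) \<partial>M) \<le> 1"
  shows "(\<integral>\<^sup>+z. g (snd z) \<partial>density (M \<Otimes>\<^sub>M N) w) \<le> (\<integral>\<^sup>+y. g y \<partial>N)"
proof -
  interpret M: finite_measure M by fact
  interpret N: finite_measure N by fact
  interpret pair_sigma_finite M N ..
  have "(\<integral>\<^sup>+z. g (snd z) \<partial>density (M \<Otimes>\<^sub>M N) w) = (\<integral>\<^sup>+z. w z * g (snd z) \<partial>(M \<Otimes>\<^sub>M N))"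
    by (subst nn_integral_density) auto
  also have "\<dots> = (\<integral>\<^sup>+y. \<integral>\<^sup>+x. w (x, y) * g y \<partial>M \<partial>N)"
    by (subst nn_integral_snd[symmetric]) auto
  also have "\<dots> = (\<integral>\<^sup>+y. (\<integral>\<^sup>+x. w (x, y) \<partial>M) * g y \<partial>N)"
    by (intro nn_integral_cong nn_integral_multc) auto
  also have "\<dots> \<le> (\<integral>\<^sup>+y. 1 * g y \<partial>N)"
    by (intro nn_integral_mono mult_right_mono w) auto
  finally show ?thesis by simp
qed

text \<open>Gluing along a countable index. With \<open>u\<^sub>i\<close> and \<open>v\<^sub>i\<close> the masses of the \<open>i\<close>-th cells, \<open>Q\<close> is the
  measure on the product that joins the \<open>i\<close>-th cells of \<open>P\<close> and \<open>R\<close> independently and gives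
  this block the mass \<open>min u\<^sub>i v\<^sub>i\<close>. Both marginals of \<open>Q\<close> are then dominated by \<open>P\<close> and \<open>R\<close>, and the
  lost mass is \<open>\<Sum> (u\<^sub>i + v\<^sub>i - 2 min u\<^sub>i v\<^sub>i) = \<Sum> |u\<^sub>i - v\<^sub>i|\<close>.\<close>

lemma glue_along_index:
  fixes j :: "'a \<Rightarrow> nat" and k :: "'b \<Rightarrow> nat"
  assumes fin: "finite_measure P" "finite_measure R"
    and [measurable]: "j \<in> P \<rightarrow>\<^sub>M count_space UNIV" "k \<in> R \<rightarrow>\<^sub>M count_space UNIV"
  obtains Q where "sets Q = sets (P \<Otimes>\<^sub>M R)" "finite_measure Q"
    "AE z in Q. j (fst z) = k (snd z)"
    "\<And>g. g \<in> borel_measurable P \<Longrightarrow> (\<integral>\<^sup>+z. g (fst z) \<partial>Q) \<le> (\<integral>\<^sup>+x. g x \<partial>P)"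
    "\<And>g. g \<in> borel_measurable R \<Longrightarrow> (\<integral>\<^sup>+z. g (snd z) \<partial>Q) \<le> (\<integral>\<^sup>+x. g x \<partial>R)"
    "mass P + mass R - 2 * mass Q \<le>
       (\<Sum>i. \<bar>measure P {x\<in>space P. j x = i} - measure R {y\<in>space R. k y = i}\<bar>)"
    "summable (\<lambda>i. \<bar>measure P {x\<in>space P. j x = i} - measure R {y\<in>space R. k y = i}\<bar>)"
proof -
  interpret P: finite_measure P by fact
  interpret R: finite_measure R by fact
  define u v where "u i = measure P {x\<in>space P. j x = i}" and "v i = measure R {y\<in>space R. k y = i}" for i
  have uv0: "0 \<le> u i" "0 \<le> v i" for i by (auto simp: u_def v_def)
  \<comment> \<open>If a cell has mass zero on one side, division by zero gives the weight 0, which is the right one.\<close>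
  define w where "w i = min (u i) (v i) / (u i * v i)" for i
  have w0: "0 \<le> w i" for i using uv0 by (simp add: w_def)
  have wv: "w i * v i \<le> 1" "w i * u i \<le> 1" and wuv: "w i * v i * u i = min (u i) (v i)" for i
    using uv0[of i] by (cases "u i = 0"; cases "v i = 0"; auto simp: w_def min_def field_simps)+
  define h where "h = (\<lambda>z. if j (fst z) = k (snd z) then ennreal (w (j (fst z))) else 0)"
  have hm [measurable]: "h \<in> borel_measurable (P \<Otimes>\<^sub>M R)"
    unfolding h_def
    by (rule measurable_compose_countable[where f = "\<lambda>i z. if i = k (snd z) then ennreal (w i) else 0" and g = "\<lambda>z. j (fst z)"])
      measurable
  define Q where "Q = density (P \<Otimes>\<^sub>M R) h"
  have hR: "(\<integral>\<^sup>+y. h (x, y) \<partial>R) = ennreal (w (j x) * v (j x))" if "x \<in> space P" for x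
  proof -
    have "(\<integral>\<^sup>+y. h (x, y) \<partial>R) = (\<integral>\<^sup>+y. ennreal (w (j x)) * indicator {y\<in>space R. k y = j x} y \<partial>R)"
      by (intro nn_integral_cong) (auto simp: h_def)
    also have "\<dots> = ennreal (w (j x)) * emeasure R {y\<in>space R. k y = j x}"
      by (rule nn_integral_cmult_indicator) measurable
    finally show ?thesis using w0 by (simp add: v_def R.emeasure_eq_measure ennreal_mult)
  qed
  have hP: "(\<integral>\<^sup>+x. h (x, y) \<partial>P) = ennreal (w (k y) * u (k y))" if "y \<in> space R" for y
  proof -
    have "(\<integral>\<^sup>+x. h (x, y) \<partial>P) = (\<integral>\<^sup>+x. ennreal (w (k y)) * indicator {x\<in>space P. j x = k y} x \<partial>P)"
      by (intro nn_integral_cong) (auto simp: h_def)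
    also have "\<dots> = ennreal (w (k y)) * emeasure P {x\<in>space P. j x = k y}"
      by (rule nn_integral_cmult_indicator) measurable
    finally show ?thesis using w0 by (simp add: u_def P.emeasure_eq_measure ennreal_mult)
  qed
  have su: "u sums mass P" and sv: "v sums mass R"
    unfolding u_def v_def by (auto intro: sums_measure_index fin)
  have smin: "summable (\<lambda>i. min (u i) (v i))"
    by (rule summable_comparison_test'[OF sums_summable[OF su], of 0]) (use uv0 in auto)
  have "emeasure Q (space Q) = (\<integral>\<^sup>+z. h z \<partial>(P \<Otimes>\<^sub>M R))"
    unfolding Q_def by (auto simp: emeasure_density intro!: nn_integral_cong)
  also have "\<dots> = (\<integral>\<^sup>+x. \<integral>\<^sup>+y. h (x, y) \<partial>R \<partial>P)"
    by (rule R.nn_integral_fst[symmetric]) measurable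
  also have "\<dots> = (\<integral>\<^sup>+x. ennreal (w (j x) * v (j x)) \<partial>P)"
    by (intro nn_integral_cong hR)
  also have "\<dots> = (\<Sum>i. ennreal (w i * v i) * emeasure P {x\<in>space P. j x = i})"
    by (rule nn_integral_nat_index) measurable
  also have "\<dots> = (\<Sum>i. ennreal (min (u i) (v i)))"
    unfolding P.emeasure_eq_measure u_def[symmetric] using w0 uv0
    by (simp add: ennreal_mult[symmetric] wuv)
  also have "\<dots> = ennreal (\<Sum>i. min (u i) (v i))"
    using uv0 smin by (intro suminf_ennreal2) auto
  finally have eQ: "emeasure Q (space Q) = ennreal (\<Sum>i. min (u i) (v i))" .
  have finQ: "finite_measure Q" by (rule finite_measureI) (simp add: eQ)
  have mQ: "mass Q = (\<Sum>i. min (u i) (v i))"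
    unfolding mass_def measure_def eQ using smin uv0 by (simp add: suminf_nonneg)
  have eq: "(\<lambda>i. \<bar>u i - v i\<bar>) = (\<lambda>i. u i + v i - 2 * min (u i) (v i))" by (auto simp: min_def)
  have "(\<lambda>i. \<bar>u i - v i\<bar>) sums (mass P + mass R - 2 * mass Q)"
    unfolding eq mQ by (intro sums_diff sums_add su sv sums_mult summable_sums smin)
  then have sm: "summable (\<lambda>i. \<bar>u i - v i\<bar>)" "mass P + mass R - 2 * mass Q = (\<Sum>i. \<bar>u i - v i\<bar>)"
    by (auto simp: sums_iff)
  have AE: "AE z in Q. j (fst z) = k (snd z)"
    unfolding Q_def AE_density[OF hm] by (rule AE_I2) (auto simp: h_def)
  show thesis
  proof (rule that[of Q])
    show "(\<integral>\<^sup>+z. g (fst z) \<partial>Q) \<le> (\<integral>\<^sup>+x. g x \<partial>P)" if "g \<in> borel_measurable P" for g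
      unfolding Q_def by (rule nn_integral_prod_fst_le) (use fin that wv in \<open>auto simp: hR\<close>)
    show "(\<integral>\<^sup>+z. g (snd z) \<partial>Q) \<le> (\<integral>\<^sup>+x. g x \<partial>R)" if "g \<in> borel_measurable R" for g
      unfolding Q_def by (rule nn_integral_prod_snd_le) (use fin that wv in \<open>auto simp: hP\<close>)
  qed (use sm finQ AE in \<open>auto simp: Q_def u_def v_def\<close>)
qed

lemma tv_mass_diff_index_le:
  fixes j :: "'a \<Rightarrow> nat"
  assumes "finite_measure \<mu>" "finite_measure \<nu>" "sets \<nu> = sets \<mu>" and [measurable]: "j \<in> \<mu> \<rightarrow>\<^sub>M count_space UNIV"
    and s: "summable (\<lambda>i. \<bar>measure \<mu> {x\<in>space \<mu>. j x = i} - measure \<nu> {x\<in>space \<mu>. j x = i}\<bar>)"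
  shows "(\<Sum>i. \<bar>measure \<mu> {x\<in>space \<mu>. j x = i} - measure \<nu> {x\<in>space \<mu>. j x = i}\<bar>) \<le> tv_mass_diff \<mu> \<nu>"
  by (rule suminf_le_const[OF s], rule tv_mass_diff_ge[OF assms(1-3)])
    (auto simp: disjoint_family_on_def)

context wasserstein_space
begin

text \<open>The plan \<open>P\<close> from \<open>\<mu>\<close> to \<open>\<nu>\<close> and the plan \<open>R\<close> from \<open>\<nu>\<close> to \<open>\<rho>\<close> are glued along the cells of their middle
  coordinates \<open>y\<close> and \<open>y'\<close>. These lie in the same cell, so \<open>d y y' \<le> \<delta>\<close>, and the cost of the resulting plan
  from \<open>x\<close> to \<open>x'\<close> is estimated by Minkowski's inequality for \<open>d x y + (\<delta> + d y' x')\<close>. The mass lost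
  in the gluing is at most \<open>|P\<^sub>2 - R\<^sub>1| \<le> |\<nu> - P\<^sub>2| + |\<nu> - R\<^sub>1|\<close>, and both terms occur in the plan values.\<close>

lemma W_le_glued_plan_values:
  assumes mu: "sets \<mu> = sets BX" "finite_measure \<mu>" and nu: "sets \<nu> = sets BX" "finite_measure \<nu>"
    and rho: "sets \<rho> = sets BX" "finite_measure \<rho>"
    and P: "partial_plan P A" and R: "partial_plan R B" and delta: "0 < \<delta>"
  shows "W \<mu> \<rho> \<le> plan_value \<mu> \<nu> P A + plan_value \<nu> \<rho> R B + b * ((mass P + 1) powr (1 / p) * \<delta>)"
proof -
  let ?K = "(mass P + 1) powr (1 / p)"
  note pP = plan_marginals[OF P] and pR = plan_marginals[OF R]
  note dP = partial_planD[OF P] and dR = partial_planD[OF R]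
  note [measurable_cong] = pP(1) pR(1)
  have mP0: "0 < mass P + 1" by (simp add: mass_def add_nonneg_pos)
  \<comment> \<open>Two points with the same index are both within \<open>\<delta>/2\<close> of one point of the dense sequence.\<close>
  define j where "j = (\<lambda>z::'a\<times>'a. cell (\<delta>/2) (snd z))"
  define k where "k = (\<lambda>z::'a\<times>'a. cell (\<delta>/2) (fst z))"
  have jm: "j \<in> P \<rightarrow>\<^sub>M count_space UNIV" and km: "k \<in> R \<rightarrow>\<^sub>M count_space UNIV"
    unfolding j_def k_def by measurable
  obtain Q where Q: "sets Q = sets (P \<Otimes>\<^sub>M R)" "finite_measure Q"
    and AE: "AE z in Q. j (fst z) = k (snd z)"
    and I1: "\<And>g. g \<in> borel_measurable P \<Longrightarrow> (\<integral>\<^sup>+z. g (fst z) \<partial>Q) \<le> (\<integral>\<^sup>+x. g x \<partial>P)"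
    and I2: "\<And>g. g \<in> borel_measurable R \<Longrightarrow> (\<integral>\<^sup>+z. g (snd z) \<partial>Q) \<le> (\<integral>\<^sup>+x. g x \<partial>R)"
    and mQ: "mass P + mass R - 2 * mass Q \<le>
       (\<Sum>i. \<bar>measure P {x\<in>space P. j x = i} - measure R {y\<in>space R. k y = i}\<bar>)"
    and sm: "summable (\<lambda>i. \<bar>measure P {x\<in>space P. j x = i} - measure R {y\<in>space R. k y = i}\<bar>)"
    by (rule glue_along_index[OF pP(3) pR(3) jm km]) (rule that)
  interpret Q: finite_measure Q by (rule Q)
  interpret P: finite_measure P by (rule pP)
  interpret R: finite_measure R by (rule pR)
  note [measurable_cong] = Q(1)
  have spQ: "space Q = (X \<times> X) \<times> (X \<times> X)"
    using sets_eq_imp_space_eq[OF Q(1)] pP pR by (simp add: space_pair_measure)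
  have QP: "emeasure Q (space Q) \<le> emeasure P (space P)"
    using I1[of "\<lambda>_. 1"] by simp
  then have mQP: "mass Q \<le> mass P" by (simp add: mass_def P.emeasure_eq_measure Q.emeasure_eq_measure)
  define F where "F = (\<lambda>z::('a\<times>'a)\<times>('a\<times>'a). (fst (fst z), snd (snd z)))"
  have Fm: "F \<in> Q \<rightarrow>\<^sub>M BX \<Otimes>\<^sub>M BX" unfolding F_def by measurable
  define N where "N = distr Q (BX \<Otimes>\<^sub>M BX) F"
  have "(\<integral>\<^sup>+z. ennreal (d (fst z) (snd z) powr p) \<partial>N) = (\<integral>\<^sup>+z. ennreal (d (fst (fst z)) (snd (snd z)) powr p) \<partial>Q)"
    unfolding N_def by (subst nn_integral_distr[OF Fm]) (auto simp: F_def)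
  also have "\<dots> \<le> ennreal ((A + (?K * \<delta> + B)) powr p)"
  proof (rule Minkowski_nn_integral[OF p dP(3), where f = "\<lambda>z. d (fst (fst z)) (snd (fst z))"
        and g = "\<lambda>z. \<delta> + d (fst (snd z)) (snd (snd z))"])
    show "(\<integral>\<^sup>+z. ennreal (d (fst (fst z)) (snd (fst z)) powr p) \<partial>Q) \<le> ennreal (A powr p)"
      using I1[of "\<lambda>z. ennreal (d (fst z) (snd z) powr p)"] dP(4) by (auto intro: order_trans)
    have 2: "(\<integral>\<^sup>+z. ennreal (d (fst (snd z)) (snd (snd z)) powr p) \<partial>Q) \<le> ennreal (B powr p)"
      using I2[of "\<lambda>z. ennreal (d (fst z) (snd z) powr p)"] dR(4) by (auto intro: order_trans)
    have 3: "(\<integral>\<^sup>+z. ennreal (\<delta> powr p) \<partial>Q) \<le> ennreal ((?K * \<delta>) powr p)"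
      using p delta mQP by (intro nn_integral_const_powr_le Q) auto
    show "(\<integral>\<^sup>+z. ennreal ((\<delta> + d (fst (snd z)) (snd (snd z))) powr p) \<partial>Q) \<le> ennreal ((?K * \<delta> + B) powr p)"
      by (rule Minkowski_nn_integral[OF p _ dR(3) _ _ _ _ _ 3 2]) (use delta mP0 in auto)
    show "AE z in Q. 0 \<le> d (fst (fst z)) (snd (snd z)) \<and>
        d (fst (fst z)) (snd (snd z)) \<le> d (fst (fst z)) (snd (fst z)) + (\<delta> + d (fst (snd z)) (snd (snd z)))"
      using AE AE_space
    proof eventually_elim
      fix z assume eq: "j (fst z) = k (snd z)" and "z \<in> space Q"
      then obtain x y y' x' where z: "z = ((x, y), (y', x'))" and X: "x \<in> X" "y \<in> X" "y' \<in> X" "x' \<in> X"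
        unfolding spQ by auto
      let ?c = "dense_seq (cell (\<delta>/2) y)"
      have c: "?c \<in> X" using dense_seq(1) X by auto
      have "d y ?c < \<delta>/2" "d y' ?c < \<delta>/2"
        using dist_cell[of y "\<delta>/2"] dist_cell[of y' "\<delta>/2"] X delta eq by (auto simp: z j_def k_def)
      then have "d y y' \<le> \<delta>" using triangle'[of y ?c y'] c X by simp
      then show "0 \<le> d (fst (fst z)) (snd (snd z)) \<and>
        d (fst (fst z)) (snd (snd z)) \<le> d (fst (fst z)) (snd (fst z)) + (\<delta> + d (fst (snd z)) (snd (snd z)))"
        using triangle[of x y x'] triangle[of y y' x'] X by (simp add: z)
    qed
  qed (use delta mP0 dR(3) in \<open>auto intro!: add_pos_pos\<close>)
  finally have N: "partial_plan N (A + (?K * \<delta> + B))"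
    using delta mP0 dP dR Q.finite_measure_distr[OF Fm]
    by (intro partial_planI) (auto simp: N_def intro!: add_pos_pos)
  have lN: "left N = distr Q BX (\<lambda>z. fst (fst z))" and rN: "right N = distr Q BX (\<lambda>z. snd (snd z))"
    unfolding N_def F_def using Fm by (auto simp: distr_distr comp_def F_def)
  note pN = plan_marginals[OF N]
  have mN: "mass N = mass Q"
    unfolding N_def mass_def using Fm by (simp add: measure_distr Int_absorb1 measurable_space subsetI vimage_def)
  have le_l: "measure (left N) B \<le> measure (left P) B" if [measurable]: "B \<in> sets BX" for B
  proof -
    have "emeasure (left N) B = (\<integral>\<^sup>+z. indicator B (fst (fst z)) \<partial>Q)"
      unfolding lN by (subst nn_integral_distr[symmetric, of _ _ BX "indicator B"]) auto
    also have "\<dots> \<le> (\<integral>\<^sup>+z. indicator B (fst z) \<partial>P)" by (rule I1) measurable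
    also have "\<dots> = emeasure (left P) B"
      by (subst nn_integral_distr[symmetric, of _ _ BX "indicator B"]) auto
    finally show ?thesis using pN(6) pP(6) by (simp add: finite_measure.emeasure_eq_measure)
  qed
  have le_r: "measure (right N) B \<le> measure (right R) B" if [measurable]: "B \<in> sets BX" for B
  proof -
    have "emeasure (right N) B = (\<integral>\<^sup>+z. indicator B (snd (snd z)) \<partial>Q)"
      unfolding rN by (subst nn_integral_distr[symmetric, of _ _ BX "indicator B"]) auto
    also have "\<dots> \<le> (\<integral>\<^sup>+z. indicator B (snd z) \<partial>R)" by (rule I2) measurable
    also have "\<dots> = emeasure (right R) B"
      by (subst nn_integral_distr[symmetric, of _ _ BX "indicator B"]) auto
    finally show ?thesis using pN(7) pR(7) by (simp add: finite_measure.emeasure_eq_measure)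
  qed
  have tl: "tv_mass_diff (left P) (left N) \<le> mass P - mass Q"
    using tv_mass_diff_dominated[OF pP(6) pN(6)] le_l pP(8) pN(8) mN by simp
  have tr: "tv_mass_diff (right R) (right N) \<le> mass R - mass Q"
    using tv_mass_diff_dominated[OF pR(7) pN(7)] le_r pR(9) pN(9) mN by simp
  have cells: "measure P {x\<in>space P. j x = i} = measure (right P) {x\<in>space (right P). cell (\<delta>/2) x = i}"
    "measure R {x\<in>space R. k x = i} = measure (left R) {x\<in>space (right P). cell (\<delta>/2) x = i}" for i
  proof -
    have cs: "{x\<in>space BX. cell (\<delta>/2) x = i} \<in> sets BX" by measurable
    have pre: "snd -` {x\<in>space BX. cell (\<delta>/2) x = i} \<inter> space P = {x\<in>space P. j x = i}"
      "fst -` {x\<in>space BX. cell (\<delta>/2) x = i} \<inter> space R = {x\<in>space R. k x = i}"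
      unfolding j_def k_def pP(2) pR(2) space_borel_of topspace_mtopology by auto
    show "measure P {x\<in>space P. j x = i} = measure (right P) {x\<in>space (right P). cell (\<delta>/2) x = i}"
      "measure R {x\<in>space R. k x = i} = measure (left R) {x\<in>space (right P). cell (\<delta>/2) x = i}"
      unfolding space_distr measure_distr[OF pP(5) cs] measure_distr[OF pR(4) cs] pre by (rule refl)+
  qed
  have "mass P + mass R - 2 * mass Q \<le> tv_mass_diff (right P) (left R)"
    using mQ sm unfolding cells
    by (intro order_trans[OF _ tv_mass_diff_index_le]) (use pP pR in auto)
  also have "\<dots> \<le> tv_mass_diff (right P) \<nu> + tv_mass_diff \<nu> (left R)"
    using pP pR nu by (intro tv_mass_diff_triangle) auto
  also have "tv_mass_diff (right P) \<nu> = tv_mass_diff \<nu> (right P)"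
    using nu by (intro tv_mass_diff_commute) auto
  finally have mid: "mass P + mass R - 2 * mass Q \<le> tv_mass_diff \<nu> (right P) + tv_mass_diff \<nu> (left R)" .
  have "tv_mass_diff \<mu> (left N) \<le> tv_mass_diff \<mu> (left P) + tv_mass_diff (left P) (left N)"
    using pP pN mu by (intro tv_mass_diff_triangle) auto
  moreover have "tv_mass_diff \<rho> (right N) \<le> tv_mass_diff \<rho> (right R) + tv_mass_diff (right R) (right N)"
    using pR pN rho by (intro tv_mass_diff_triangle) auto
  ultimately have "tv_mass_diff \<mu> (left N) + tv_mass_diff \<rho> (right N) \<le>
      tv_mass_diff \<mu> (left P) + tv_mass_diff \<nu> (right P) + (tv_mass_diff \<nu> (left R) + tv_mass_diff \<rho> (right R))"
    using mid tl tr by linarith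
  from mult_left_mono[OF this, of a] a W_le_plan_value[OF N, of \<mu> \<rho>] show ?thesis
    unfolding plan_value_def distrib_left by linarith
qed

lemma W_triangle:
  assumes mu: "sets \<mu> = sets BX" "finite_measure \<mu>" and nu: "sets \<nu> = sets BX" "finite_measure \<nu>"
    and rho: "sets \<rho> = sets BX" "finite_measure \<rho>"
  shows "W \<mu> \<rho> \<le> W \<mu> \<nu> + W \<nu> \<rho>"
proof (rule field_le_epsilon)
  fix t :: real assume t: "0 < t"
  obtain P A where P: "partial_plan P A" "plan_value \<mu> \<nu> P A < W \<mu> \<nu> + t / 4"
    using W_less_obtain_plan[of \<mu> \<nu> "W \<mu> \<nu> + t / 4"] t by auto
  obtain R B where R: "partial_plan R B" "plan_value \<nu> \<rho> R B < W \<nu> \<rho> + t / 4"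
    using W_less_obtain_plan[of \<nu> \<rho> "W \<nu> \<rho> + t / 4"] t by auto
  have "0 < mass P + 1" by (simp add: mass_def add_nonneg_pos)
  then have K: "0 < (mass P + 1) powr (1 / p)" by (metis powr_gt_zero less_irrefl)
  then have "0 < t / (2 * b * (mass P + 1) powr (1 / p))" using t b by simp
  from W_le_glued_plan_values[OF mu nu rho P(1) R(1) this] K b
  have "W \<mu> \<rho> \<le> plan_value \<mu> \<nu> P A + plan_value \<nu> \<rho> R B + t / 2" by simp
  then show "W \<mu> \<rho> \<le> W \<mu> \<nu> + W \<nu> \<rho> + t" using P(2) R(2) by linarith
qed

end

section \<open>The metric and its evaluation maps\<close>

lemma tendsto_linear_plus_powr:
  fixes a c p t :: real
  assumes "0 < a" "0 < c" "0 < p"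
  shows "((\<lambda>s. t + s / a + (s / c) powr p) \<longlongrightarrow> t) (at_right 0)"
proof -
  have "((\<lambda>s. s / c) \<longlongrightarrow> 0 / c) (at_right 0)" "((\<lambda>s. s / a) \<longlongrightarrow> 0 / a) (at_right 0)"
    by (intro tendsto_divide tendsto_const tendsto_ident_at; use assms in simp)+
  moreover have "eventually (\<lambda>s. 0 \<le> s / c) (at_right 0)"
    using assms by (intro eventually_at_rightI[of 0 1]) auto
  ultimately have "((\<lambda>s. t + s / a + (s / c) powr p) \<longlongrightarrow> t + 0 / a + 0) (at_right 0)"
    using assms by (intro tendsto_add tendsto_const tendsto_zero_powrI[where b = p]) auto
  then show ?thesis by simp
qed

context wasserstein_space
begin

lemma measurable_interior_part:
  shows "{x\<in>X. \<forall>y\<in>X. d x y < r \<longrightarrow> y \<in> U} \<in> sets BX"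
proof -
  have "openin mtopology (\<Union>y\<in>X-U. mball y r)" by auto
  then have "X - (\<Union>y\<in>X-U. mball y r) \<in> sets BX"
    using sets.compl_sets[OF borel_of_open] by fastforce
  also have "X - (\<Union>y\<in>X-U. mball y r) = {x\<in>X. \<forall>y\<in>X. d x y < r \<longrightarrow> y \<in> U}"
    by (auto simp: commute)
  finally show ?thesis .
qed

text \<open>Points of the set on the left lie at distance at least \<open>r\<close> from the complement of \<open>U\<close>. So the
  mass that a plan moves from this set to the complement of \<open>U\<close> travels at least the distance \<open>r\<close>,
  and Markov's inequality bounds it.\<close>

lemma W_measure_le:
  assumes mu: "sets \<mu> = sets BX" "finite_measure \<mu>" and nu: "sets \<nu> = sets BX" "finite_measure \<nu>"
    and U: "U \<in> sets BX" and r: "0 < r" and W: "W \<mu> \<nu> < s"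
  shows "measure \<mu> {x\<in>X. \<forall>y\<in>X. d x y < r \<longrightarrow> y \<in> U} \<le> measure \<nu> U + s / a + (s / (b * r)) powr p"
proof -
  obtain P A where P: "partial_plan P A" and v: "plan_value \<mu> \<nu> P A < s"
    by (rule W_less_obtain_plan[OF W])
  note pP = plan_marginals[OF P] and dP = partial_planD[OF P]
  note [measurable_cong] = pP(1)
  interpret P: finite_measure P by (rule pP)
  let ?V = "{x\<in>X. \<forall>y\<in>X. d x y < r \<longrightarrow> y \<in> U}"
  let ?t1 = "tv_mass_diff \<mu> (left P)" and ?t2 = "tv_mass_diff \<nu> (right P)"
  have V: "?V \<in> sets BX" by (rule measurable_interior_part)
  let ?E = "{z\<in>space P. r \<le> d (fst z) (snd z)}"
  have E: "?E \<in> sets P" by measurable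
  have "ennreal (r powr p) * emeasure P ?E = (\<integral>\<^sup>+z. ennreal (r powr p) * indicator ?E z \<partial>P)"
    using E by (rule nn_integral_cmult_indicator[symmetric])
  also have "\<dots> \<le> (\<integral>\<^sup>+z. ennreal (d (fst z) (snd z) powr p) \<partial>P)"
    using r p by (intro nn_integral_mono) (auto simp: indicator_def intro!: ennreal_leI powr_mono2)
  also have "\<dots> \<le> ennreal (A powr p)" by (rule dP)
  finally have "r powr p * measure P ?E \<le> A powr p"
    by (simp add: P.emeasure_eq_measure ennreal_mult[symmetric])
  then have mE: "measure P ?E \<le> (A / r) powr p"
    using r dP(3) by (simp add: powr_divide field_simps)
  have "a * ?t1 + a * ?t2 + b * A < s" using v by (simp add: plan_value_def)
  moreover have "0 \<le> a * ?t1" "0 \<le> a * ?t2" "0 < b * A" using a b dP(3) by auto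
  ultimately have "a * (?t1 + ?t2) \<le> s" "b * A \<le> s" by (auto simp: distrib_left)
  then have t12: "?t1 + ?t2 \<le> s / a" and "A \<le> s / b"
    using a b by (auto simp: field_simps)
  then have "A / r \<le> s / (b * r)" using r by (simp add: field_simps)
  then have "(A / r) powr p \<le> (s / (b * r)) powr p" using dP(3) r p by (intro powr_mono2) auto
  moreover have "measure \<mu> ?V \<le> measure (left P) ?V + ?t1"
    using tv_mass_diff_ge_single[OF mu(2) pP(6), of ?V] mu V by auto
  moreover have "measure (right P) U \<le> measure \<nu> U + ?t2"
    using tv_mass_diff_ge_single[OF nu(2) pP(7), of U] nu U by auto
  moreover have "measure (left P) ?V \<le> measure (right P) U + measure P ?E"
  proof -
    have "measure (left P) ?V = measure P (fst -` ?V \<inter> space P)"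
      using V by (rule measure_distr[OF pP(4)])
    also have "\<dots> \<le> measure P ((snd -` U \<inter> space P) \<union> ?E)"
    proof (rule P.finite_measure_mono)
      show "fst -` ?V \<inter> space P \<subseteq> (snd -` U \<inter> space P) \<union> ?E" by (auto simp: pP(2) not_le)
      show "(snd -` U \<inter> space P) \<union> ?E \<in> sets P" using E measurable_sets[OF pP(5) U] by auto
    qed
    also have "\<dots> \<le> measure P (snd -` U \<inter> space P) + measure P ?E"
      using E measurable_sets[OF pP(5) U] by (intro measure_Un_le)
    also have "measure P (snd -` U \<inter> space P) = measure (right P) U"
      using U by (rule measure_distr[OF pP(5), symmetric])
    finally show ?thesis .
  qed
  ultimately show ?thesis using mE t12 by linarith
qed

lemma interior_part_tendsto:
  assumes mu: "sets \<mu> = sets BX" "finite_measure \<mu>" and U: "openin mtopology U"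
  shows "(\<lambda>n. measure \<mu> {x\<in>X. \<forall>y\<in>X. d x y < inverse (real (Suc n)) \<longrightarrow> y \<in> U}) \<longlonglongrightarrow> measure \<mu> U"
proof -
  interpret finite_measure \<mu> by fact
  let ?V = "\<lambda>n. {x\<in>X. \<forall>y\<in>X. d x y < inverse (real (Suc n)) \<longrightarrow> y \<in> U}"
  have "incseq ?V"
  proof (rule incseq_SucI, safe)
    fix n x y assume h: "\<forall>y\<in>X. d x y < inverse (real (Suc n)) \<longrightarrow> y \<in> U" and "y \<in> X"
      and d: "d x y < inverse (real (Suc (Suc n)))"
    have "inverse (real (Suc (Suc n))) \<le> inverse (real (Suc n))" by (rule le_imp_inverse_le) auto
    then have "d x y < inverse (real (Suc n))" using d by linarith
    then show "y \<in> U" using h \<open>y \<in> X\<close> by blast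
  qed
  moreover have "(\<Union>n. ?V n) = U"
  proof (intro equalityI subsetI)
    fix x assume "x \<in> (\<Union>n. ?V n)"
    then show "x \<in> U" by fastforce
  next
    fix x assume x: "x \<in> U"
    then obtain r where r: "0 < r" "mball x r \<subseteq> U"
      using iffD1[OF openin_mtopology U] by auto
    have X: "x \<in> X" using x openin_subset[OF U] by auto
    obtain n where n: "inverse (real (Suc n)) < r" using reals_Archimedean[OF r(1)] by auto
    have "y \<in> U" if "y \<in> X" "d x y < inverse (real (Suc n))" for y
      using that r(2) n X by (auto dest!: subsetD[of _ _ y])
    then show "x \<in> (\<Union>n. ?V n)" using X by blast
  qed
  ultimately show ?thesis
    using finite_Lim_measure_incseq[of ?V] measurable_interior_part mu(1) by auto
qed

lemma W_zero_open_le: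
  assumes mu: "sets \<mu> = sets BX" "finite_measure \<mu>" and nu: "sets \<nu> = sets BX" "finite_measure \<nu>"
    and U: "openin mtopology U" and W: "W \<mu> \<nu> = 0"
  shows "measure \<mu> U \<le> measure \<nu> U"
proof (rule LIMSEQ_le_const2[OF interior_part_tendsto[OF mu U]], intro exI allI impI)
  fix n
  let ?r = "inverse (real (Suc n))"
  let ?V = "{x\<in>X. \<forall>y\<in>X. d x y < ?r \<longrightarrow> y \<in> U}"
  have "((\<lambda>s. measure \<nu> U + s / a + (s / (b * ?r)) powr p) \<longlongrightarrow> measure \<nu> U) (at_right 0)"
    using p a b by (intro tendsto_linear_plus_powr) auto
  moreover have "eventually (\<lambda>s. measure \<mu> ?V \<le> measure \<nu> U + s / a + (s / (b * ?r)) powr p) (at_right 0)"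
    using W_measure_le[OF mu nu borel_of_open[OF U], of ?r] W by (intro eventually_at_rightI[of 0 1]) auto
  ultimately show "measure \<mu> ?V \<le> measure \<nu> U"
    using tendsto_lowerbound[of _ _ "at_right (0::real)"] by force
qed

text \<open>Measures at distance zero agree on the open sets, which generate the Borel sets and are stable under
  intersection.\<close>

lemma W_zero_imp_eq:
  assumes mu: "sets \<mu> = sets BX" "finite_measure \<mu>" and nu: "sets \<nu> = sets BX" "finite_measure \<nu>"
    and W: "W \<mu> \<nu> = 0"
  shows "\<mu> = \<nu>"
proof (rule measure_eqI_generator_eq[where E = "{U. openin mtopology U}" and \<Omega> = X and A = "\<lambda>_. X"])
  interpret M: finite_measure \<mu> by fact
  interpret N: finite_measure \<nu> by fact
  show "Int_stable {U. openin mtopology U}" by (auto simp: Int_stable_def)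
  show "{U. openin mtopology U} \<subseteq> Pow X" using openin_subset by fastforce
  fix U assume "U \<in> {U. openin mtopology U}"
  then have U: "openin mtopology U" by simp
  have "W \<nu> \<mu> = 0" using W W_commute by simp
  from W_zero_open_le[OF mu nu U W] W_zero_open_le[OF nu mu U this]
  show "emeasure \<mu> U = emeasure \<nu> U" by (simp add: M.emeasure_eq_measure N.emeasure_eq_measure)
next
  interpret M: finite_measure \<mu> by fact
  show "emeasure \<mu> X \<noteq> \<infinity>" by (simp add: M.emeasure_eq_measure)
  show "range (\<lambda>_. X) \<subseteq> {U. openin mtopology U}" by auto
qed (use mu nu in \<open>auto simp: sets_borel_of\<close>)

lemma measures_p_C_iff:
  "\<mu> \<in> measures_p_C X d p C \<longleftrightarrow> sets \<mu> = sets BX \<and> finite_measure \<mu> \<and> mass \<mu> \<le> C"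
  by (auto simp: measures_p_C_def measures_p_eq)

lemma W_metric: "Metric_space (measures_p_C X d p C) W"
proof
  fix \<mu> \<nu> \<rho>
  show "0 \<le> W \<mu> \<nu>" by (rule W_nonneg)
  show "W \<mu> \<nu> = W \<nu> \<mu>" by (rule W_commute)
  show "W \<mu> \<nu> = 0 \<longleftrightarrow> \<mu> = \<nu>" if "\<mu> \<in> measures_p_C X d p C" "\<nu> \<in> measures_p_C X d p C"
    using that W_zero_imp_eq[of \<mu> \<nu>] W_self[of \<mu>] by (auto simp: measures_p_C_iff)
  show "W \<mu> \<rho> \<le> W \<mu> \<nu> + W \<nu> \<rho>"
    if "\<mu> \<in> measures_p_C X d p C" "\<nu> \<in> measures_p_C X d p C" "\<rho> \<in> measures_p_C X d p C"
    using that by (intro W_triangle) (auto simp: measures_p_C_iff)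
qed

abbreviation BM :: "real \<Rightarrow> 'a measure measure" where
  "BM C \<equiv> metric_borel (measures_p_C X d p C) W"

lemma space_BM: "space (BM C) = measures_p_C X d p C"
  by (simp add: Metric_space.topspace_mtopology[OF W_metric])

text \<open>If \<open>\<mu> U > t\<close>, then already the points of \<open>U\<close> at distance at least some \<open>r\<close> from the complement have \<open>\<mu>\<close>-mass
  greater than \<open>t\<close>, and \<open>W_measure_le\<close> passes this on to all measures near \<open>\<mu>\<close>.\<close>

lemma measure_open_lower_semicontinuous:
  assumes U: "openin mtopology U"
  shows "openin (Metric_space.mtopology (measures_p_C X d p C) W) {\<mu>\<in>measures_p_C X d p C. t < measure \<mu> U}"
  unfolding Metric_space.openin_mtopology[OF W_metric]
proof (intro conjI allI impI)
  fix \<mu> assume "\<mu> \<in> {\<mu>\<in>measures_p_C X d p C. t < measure \<mu> U}"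
  then have m: "\<mu> \<in> measures_p_C X d p C" "t < measure \<mu> U" by auto
  then have mu: "sets \<mu> = sets BX" "finite_measure \<mu>" by (auto simp: measures_p_C_iff)
  have "eventually (\<lambda>n. t < measure \<mu> {x\<in>X. \<forall>y\<in>X. d x y < inverse (real (Suc n)) \<longrightarrow> y \<in> U}) sequentially"
    by (rule order_tendstoD(1)[OF interior_part_tendsto[OF mu U] m(2)])
  then obtain n where n: "t < measure \<mu> {x\<in>X. \<forall>y\<in>X. d x y < inverse (real (Suc n)) \<longrightarrow> y \<in> U}"
    unfolding eventually_sequentially by blast
  define r where "r = inverse (real (Suc n))"
  define m0 where "m0 = measure \<mu> {x\<in>X. \<forall>y\<in>X. d x y < r \<longrightarrow> y \<in> U}"
  have r: "0 < r" "t < m0" using n by (auto simp: r_def m0_def)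
  have "((\<lambda>s. t + s / a + (s / (b * r)) powr p) \<longlongrightarrow> t) (at_right 0)"
    using p a b r by (intro tendsto_linear_plus_powr) auto
  then have "eventually (\<lambda>s. t + s / a + (s / (b * r)) powr p < m0) (at_right 0)"
    using r(2) by (intro order_tendstoD(2)) auto
  then obtain s where s: "0 < s" "t + s / a + (s / (b * r)) powr p < m0"
    unfolding eventually_at_right_field by (metis dense)
  have "Metric_space.mball (measures_p_C X d p C) W \<mu> s \<subseteq> {\<mu>\<in>measures_p_C X d p C. t < measure \<mu> U}"
  proof
    fix \<nu> assume "\<nu> \<in> Metric_space.mball (measures_p_C X d p C) W \<mu> s"
    then have n: "\<nu> \<in> measures_p_C X d p C" "W \<mu> \<nu> < s"
      by (auto simp: Metric_space.in_mball[OF W_metric])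
    then have "m0 \<le> measure \<nu> U + s / a + (s / (b * r)) powr p"
      unfolding m0_def using W_measure_le[OF mu _ _ borel_of_open[OF U] r(1), of \<nu> s] by (auto simp: measures_p_C_iff)
    then show "\<nu> \<in> {\<mu>\<in>measures_p_C X d p C. t < measure \<mu> U}" using n s by auto
  qed
  then show "\<exists>r>0. Metric_space.mball (measures_p_C X d p C) W \<mu> r \<subseteq> {\<mu>\<in>measures_p_C X d p C. t < measure \<mu> U}"
    using s(1) by blast
qed auto

text \<open>The Borel sets with this property contain the open sets, by semicontinuity, and are closed under
  complements and disjoint countable unions, so the claim follows from Dynkin's theorem.\<close>

lemma evaluation_measurable:
  assumes "B \<in> sets BX"
  shows "(\<lambda>\<mu>. measure \<mu> B) \<in> borel_measurable (BM C)"
proof -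
  have opens: "(\<lambda>\<mu>. measure \<mu> U) \<in> borel_measurable (BM C)" if "openin mtopology U" for U
    using measure_open_lower_semicontinuous[OF that]
    by (subst borel_measurable_iff_greater) (auto simp: space_BM simp del: space_borel_of intro!: borel_of_open)
  have m: "sets \<mu> = sets BX" "finite_measure \<mu>" "space \<mu> = X" if "\<mu> \<in> space (BM C)" for \<mu>
    using that sets_eq_imp_space_eq[of \<mu> BX] by (auto simp: space_BM measures_p_C_iff simp del: space_borel_of)
      (simp_all add: space_borel_of)
  have "Int_stable {U. openin mtopology U}" by (auto simp: Int_stable_def)
  moreover have "{U. openin mtopology U} \<subseteq> Pow X" using openin_subset by fastforce
  moreover have "B \<in> sigma_sets X {U. openin mtopology U}" using assms by (simp add: sets_borel_of)
  ultimately show ?thesis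
  proof (induction rule: sigma_sets_induct_disjoint)
    case (compl A)
    have "measure \<mu> (X - A) = measure \<mu> X - measure \<mu> A" if "\<mu> \<in> space (BM C)" for \<mu>
      using finite_measure.finite_measure_compl[OF m(2)[OF that], of A] m[OF that] compl(1)
      by (simp add: sets_borel_of)
    moreover have "(\<lambda>\<mu>. measure \<mu> X - measure \<mu> A) \<in> borel_measurable (BM C)"
      using compl(2) opens[of X] by simp
    ultimately show ?case by (subst measurable_cong) auto
  next
    case (union A)
    have "measure \<mu> (\<Union>i. A i) = (\<Sum>i. measure \<mu> (A i))" if "\<mu> \<in> space (BM C)" for \<mu>
    proof -
      have "(\<lambda>i. measure \<mu> (A i)) sums measure \<mu> (\<Union>i. A i)"
        using union(1,2) m[OF that]
        by (intro finite_measure.finite_measure_UNION) (auto simp: sets_borel_of)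
      then show ?thesis by (simp add: sums_iff)
    qed
    moreover have "(\<lambda>\<mu>. \<Sum>i. measure \<mu> (A i)) \<in> borel_measurable (BM C)"
      using union(3) by (intro borel_measurable_suminf)
    ultimately show ?case by (subst measurable_cong) auto
  qed (use opens in auto)
qed

end

section \<open>Measurability of the push-forward map\<close>

text \<open>On a countable discrete space, the total variation is determined by the atoms: each
  atom lies in exactly one part of a partition.\<close>

lemma tv_mass_diff_nat_le:
  fixes m n :: "nat measure"
  assumes m: "finite_measure m" "sets m = UNIV" and n: "finite_measure n" "sets n = UNIV"
  shows "summable (\<lambda>i. \<bar>measure m {i} - measure n {i}\<bar>)"
    "tv_mass_diff m n \<le> (\<Sum>i. \<bar>measure m {i} - measure n {i}\<bar>)"
proof -
  define c where "c i = \<bar>measure m {i} - measure n {i}\<bar>" for i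
  have sums: "(\<lambda>i. indicator A i * measure M {i}) sums measure M A" if "finite_measure M" "sets M = UNIV" for M A
  proof -
    have "(\<lambda>i. measure M (A \<inter> {i})) sums measure M (\<Union>i. A \<inter> {i})"
      using that by (intro finite_measure.finite_measure_UNION) (auto simp: disjoint_family_on_def)
    moreover have "(\<Union>i. A \<inter> {i}) = A" by auto
    moreover have "measure M (A \<inter> {i}) = indicator A i * measure M {i}" for i
      by (cases "i \<in> A") auto
    ultimately show ?thesis by simp
  qed
  have "(\<lambda>i. measure m {i}) sums measure m UNIV" "(\<lambda>i. measure n {i}) sums measure n UNIV"
    using sums[OF m, of UNIV] sums[OF n, of UNIV] by auto
  then have "summable (\<lambda>i. measure m {i} + measure n {i})" by (auto intro: summable_add sums_summable)
  then have sc: "summable c"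
    by (rule summable_comparison_test'[of _ 0]) (auto simp: c_def intro: order_trans[OF abs_triangle_ineq4])
  then show "summable (\<lambda>i. \<bar>measure m {i} - measure n {i}\<bar>)" by (simp add: c_def[abs_def])
  have "tv_mass_diff m n \<le> suminf c"
  proof (rule tv_mass_diff_le)
    show "0 \<le> suminf c" using sc by (rule suminf_nonneg) (simp add: c_def)
    fix P assume P: "finite P" "P \<subseteq> sets m" "partition_on (space m) P"
    have si: "summable (\<lambda>i. indicator A i * c i)" for A
      by (rule summable_comparison_test'[OF sc, of 0]) (auto simp: indicator_def c_def)
    have one: "\<bar>measure m A - measure n A\<bar> \<le> (\<Sum>i. indicator A i * c i)" for A
    proof -
      have "(\<lambda>i. indicator A i * measure m {i} - indicator A i * measure n {i}) sums (measure m A - measure n A)"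
        by (intro sums_diff sums m n)
      then have eq: "measure m A - measure n A = (\<Sum>i. indicator A i * (measure m {i} - measure n {i}))"
        by (simp add: sums_iff right_diff_distrib)
      have abs: "\<bar>indicator A i * (measure m {i} - measure n {i})\<bar> = indicator A i * c i" for i
        by (simp add: c_def abs_mult)
      show ?thesis unfolding eq
        using summable_rabs[of "\<lambda>i. indicator A i * (measure m {i} - measure n {i})"] si[of A] by (simp add: abs)
    qed
    have "(\<Sum>A\<in>P. \<bar>measure m A - measure n A\<bar>) \<le> (\<Sum>A\<in>P. \<Sum>i. indicator A i * c i)"
      by (intro sum_mono one)
    also have "\<dots> = (\<Sum>i. \<Sum>A\<in>P. indicator A i * c i)"
      by (rule suminf_sum[symmetric]) (rule si)
    also have "\<dots> \<le> suminf c"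
    proof (rule suminf_le[OF _ _ sc])
      fix i
      have "space m = UNIV" using m(2) sets.sets_into_space[of UNIV m] by auto
      then obtain B where B: "B \<in> P" "i \<in> B" using P(3) by (auto simp: partition_on_def)
      have "A = B" if "A \<in> P" "i \<in> A" for A
        using P(3) B that by (auto simp: partition_on_def disjoint_def)
      then have "indicator A i * c i = (if A = B then c i else 0)" if "A \<in> P" for A
        using that B(2) by (cases "i \<in> A") auto
      then have "(\<Sum>A\<in>P. indicator A i * c i) = (\<Sum>A\<in>P. if A = B then c i else 0)"
        by (intro sum.cong refl)
      also have "\<dots> = c i" using P(1) B(1) by (simp only: sum.delta if_True)
      finally show "(\<Sum>A\<in>P. indicator A i * c i) \<le> c i" by (simp only: order_refl)
      show "summable (\<lambda>i. \<Sum>A\<in>P. indicator A i * c i)" by (intro summable_sum si)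
    qed
    finally show "(\<Sum>A\<in>P. \<bar>measure m A - measure n A\<bar>) \<le> suminf c" .
  qed
  then show "tv_mass_diff m n \<le> (\<Sum>i. \<bar>measure m {i} - measure n {i}\<bar>)" by (simp add: c_def[abs_def])
qed

text \<open>The rational sequences of finite support, coded by lists so that there are visibly countably many of
  them. They are dense among the nonnegative summable sequences.\<close>

definition list_seq :: "rat list \<Rightarrow> nat \<Rightarrow> real" where
  "list_seq q i = (if i < length q then of_rat (q ! i) else 0)"

text \<open>The tail of the sequence is replaced by zero, each of the first \<open>n\<close> terms by a rational
  number within \<open>\<epsilon> / (2(n+1))\<close>.\<close>

lemma list_seq_dense:
  assumes u: "summable u" "\<And>i. 0 \<le> u i" and e: "0 < \<epsilon>"
  shows "\<exists>q. (\<Sum>i. \<bar>u i - list_seq q i\<bar>) < \<epsilon>"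
proof -
  obtain n where n: "norm (\<Sum>i. u (i + n)) < \<epsilon> / 2"
    using suminf_exist_split[of "\<epsilon>/2" u] u(1) e by auto
  define t where "t = \<epsilon> / (2 * real (Suc n))"
  have t: "0 < t" using e by (simp add: t_def)
  have "\<exists>q::rat. u i < of_rat q \<and> of_rat q < u i + t" for i
    using t by (intro of_rat_dense) simp
  then obtain r :: "nat \<Rightarrow> rat" where r: "\<And>i. u i < of_rat (r i) \<and> of_rat (r i) < u i + t" by metis
  define q where "q = map r [0..<n]"
  have q: "list_seq q i = (if i < n then of_rat (r i) else 0)" for i by (simp add: list_seq_def q_def)
  have sm: "summable (\<lambda>i. \<bar>u i - list_seq q i\<bar>)"
  proof (rule summable_comparison_test'[of "\<lambda>i. u i + \<bar>list_seq q i\<bar>" 0])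
    show "summable (\<lambda>i. u i + \<bar>list_seq q i\<bar>)"
      by (intro summable_add u(1) summable_finite[of "{..<length q}"]) (auto simp: list_seq_def)
    show "norm \<bar>u i - list_seq q i\<bar> \<le> u i + \<bar>list_seq q i\<bar>" if "0 \<le> i" for i
      using u(2)[of i] by (auto simp: abs_if)
  qed
  have "(\<Sum>i. \<bar>u i - list_seq q i\<bar>) = (\<Sum>i. \<bar>u (i + n) - list_seq q (i + n)\<bar>) + (\<Sum>i<n. \<bar>u i - list_seq q i\<bar>)"
    by (rule suminf_split_initial_segment[OF sm])
  also have "(\<Sum>i. \<bar>u (i + n) - list_seq q (i + n)\<bar>) = (\<Sum>i. u (i + n))"
    using u(2) by (simp add: q)
  also have "\<dots> < \<epsilon> / 2" using n by (simp add: abs_less_iff)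
  also have "(\<Sum>i<n. \<bar>u i - list_seq q i\<bar>) \<le> (\<Sum>i<n. t)"
    using r by (intro sum_mono) (auto simp: q abs_if less_imp_le algebra_simps)
  also have "(\<Sum>i<n. t) \<le> \<epsilon> / 2" using e by (simp add: t_def field_simps)
  finally show ?thesis by (intro exI[of _ q]) simp
qed

context wasserstein_space
begin

text \<open>The diagonal plan of \<open>\<nu>\<close> has cost zero and both marginals equal to \<open>\<nu>\<close>. Its cost bound has
  to be positive, hence the arbitrarily small \<open>t\<close>.\<close>

lemma W_le_tv:
  assumes mu: "sets \<mu> = sets BX" "finite_measure \<mu>" and nu: "sets \<nu> = sets BX" "finite_measure \<nu>"
  shows "W \<mu> \<nu> \<le> a * tv_mass_diff \<mu> \<nu>"
proof (rule field_le_epsilon)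
  fix t :: real assume t: "0 < t"
  note [measurable_cong] = nu(1)
  define P where "P = distr \<nu> (BX \<Otimes>\<^sub>M BX) (\<lambda>x. (x, x))"
  have m: "(\<lambda>x. (x, x)) \<in> \<nu> \<rightarrow>\<^sub>M BX \<Otimes>\<^sub>M BX" by measurable
  have "(\<integral>\<^sup>+z. ennreal (d (fst z) (snd z) powr p) \<partial>P) = (\<integral>\<^sup>+x. ennreal (d x x powr p) \<partial>\<nu>)"
    unfolding P_def by (subst nn_integral_distr[OF m]) auto
  also have "\<dots> = (\<integral>\<^sup>+x. 0 \<partial>\<nu>)"
    using sets_eq_imp_space_eq[OF nu(1)] by (intro nn_integral_cong) simp
  finally have P: "partial_plan P (t / b)"
    using t b finite_measure.finite_measure_distr[OF nu(2) m]
    by (intro partial_planI) (auto simp: P_def)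
  have "left P = distr \<nu> BX (\<lambda>x. x)" "right P = distr \<nu> BX (\<lambda>x. x)"
    unfolding P_def by (auto simp: distr_distr comp_def)
  moreover have "distr \<nu> BX (\<lambda>x. x) = \<nu>" using nu by (intro distr_id2) auto
  ultimately show "W \<mu> \<nu> \<le> a * tv_mass_diff \<mu> \<nu> + t"
    using W_le_plan_value[OF P, of \<mu> \<nu>] b by (simp add: plan_value_def)
qed

lemma cell_mass_sums:
  assumes mu: "sets \<mu> = sets BX" "finite_measure \<mu>"
  shows "(\<lambda>i. measure \<mu> {x\<in>X. cell \<delta> x = i}) sums mass \<mu>"
proof -
  have "cell \<delta> \<in> \<mu> \<rightarrow>\<^sub>M count_space UNIV"
    using mu by (simp cong: measurable_cong_sets)
  from sums_measure_index[OF mu(2) this] show ?thesis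
    using sets_eq_imp_space_eq[OF mu(1)] by simp
qed

text \<open>Moving every point to the centre of its cell changes \<open>\<mu>\<close> and \<open>\<nu>\<close> little. The resulting
  measures live on a countable set, where total variation is the sum of the differences of the point
  masses.\<close>

lemma W_le_cells:
  assumes mu: "sets \<mu> = sets BX" "finite_measure \<mu>" "mass \<mu> \<le> C"
    and nu: "sets \<nu> = sets BX" "finite_measure \<nu>" "mass \<nu> \<le> C"
    and pos: "0 < \<delta>" "0 < C"
  shows "W \<mu> \<nu> \<le> 2 * (b * (C powr (1 / p) * \<delta>)) +
    a * (\<Sum>i. \<bar>measure \<mu> {x\<in>X. cell \<delta> x = i} - measure \<nu> {x\<in>X. cell \<delta> x = i}\<bar>)"
proof -
  have cm: "cell \<delta> \<in> \<rho> \<rightarrow>\<^sub>M count_space UNIV" if "sets \<rho> = sets BX" for \<rho>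
    using that by (simp cong: measurable_cong_sets)
  define D where "D \<rho> = distr \<rho> (count_space UNIV) (cell \<delta>)" for \<rho>
  have D: "finite_measure (D \<rho>)" "sets (D \<rho>) = UNIV" "measure (D \<rho>) {i} = measure \<rho> {x\<in>X. cell \<delta> x = i}"
    if "sets \<rho> = sets BX" "finite_measure \<rho>" for \<rho> i
    using that cm[OF that(1)] sets_eq_imp_space_eq[OF that(1)]
    by (auto simp: D_def finite_measure.finite_measure_distr measure_distr vimage_def Int_def conj_commute)
  note tvn = tv_mass_diff_nat_le[OF D(1,2)[OF mu(1,2)] D(1,2)[OF nu(1,2)]]
  note tvn' = tvn[unfolded D(3)[OF mu(1,2)] D(3)[OF nu(1,2)]]
  show ?thesis
  proof (cases "X = {}")
    case True
    have "space \<mu> = X" "space \<nu> = X"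
      using sets_eq_imp_space_eq[OF mu(1)] sets_eq_imp_space_eq[OF nu(1)] by simp_all
    then have "space \<mu> = {}" "space \<nu> = {}" unfolding True by simp_all
    then have "mass \<mu> = 0" "mass \<nu> = 0" by (simp_all add: mass_def)
    then have "W \<mu> \<nu> \<le> 0" using W_le_masses[OF mu(1,2) nu(1,2)] by simp
    moreover have "0 \<le> (\<Sum>i. \<bar>measure \<mu> {x\<in>X. cell \<delta> x = i} - measure \<nu> {x\<in>X. cell \<delta> x = i}\<bar>)"
      by (rule suminf_nonneg[OF tvn'(1)]) simp
    ultimately show ?thesis using a b pos by (auto intro: order_trans)
  next
    case False
    have dm: "dense_seq \<in> count_space UNIV \<rightarrow>\<^sub>M BX" using dense_seq(1)[OF False] by auto
    define g where "g x = dense_seq (cell \<delta> x)" for x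
    have gm: "g \<in> \<rho> \<rightarrow>\<^sub>M BX" if "sets \<rho> = sets BX" for \<rho>
      unfolding g_def using measurable_compose[OF cm[OF that] dm] .
    have close: "W \<rho> (distr \<rho> BX g) \<le> b * (C powr (1 / p) * \<delta>)" if r: "sets \<rho> = sets BX" "finite_measure \<rho>" "mass \<rho> \<le> C" for \<rho>
    proof -
      have "W (distr \<rho> BX (\<lambda>x. x)) (distr \<rho> BX g) \<le> b * (C powr (1 / p) * \<delta>)"
      proof (rule W_distr_close[OF r(2,3) _ gm[OF r(1)]])
        show "(\<lambda>x. x) \<in> \<rho> \<rightarrow>\<^sub>M BX" using r(1) by (simp cong: measurable_cong_sets)
        show "d x (g x) \<le> \<delta>" if "x \<in> space \<rho>" for x
          using that dist_cell[of x \<delta>] pos sets_eq_imp_space_eq[OF r(1)] by (auto simp: g_def less_imp_le)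
      qed (use pos in auto)
      moreover have "distr \<rho> BX (\<lambda>x. x) = \<rho>" using r by (intro distr_id2) auto
      ultimately show ?thesis by simp
    qed
    have gD: "distr \<rho> BX g = distr (D \<rho>) BX dense_seq" if "sets \<rho> = sets BX" for \<rho>
      unfolding D_def g_def[abs_def] using distr_distr[OF dm cm[OF that]] by (simp add: comp_def)
    have dm': "dense_seq \<in> D \<mu> \<rightarrow>\<^sub>M BX" 
      unfolding D_def by (subst measurable_cong_sets[OF sets_distr refl]) (rule dm)
    have fin: "finite_measure (distr \<mu> BX g)" "finite_measure (distr \<nu> BX g)"
      using mu nu gm by (auto intro: finite_measure.finite_measure_distr)
    have "W (distr \<mu> BX g) (distr \<nu> BX g) \<le> a * tv_mass_diff (distr \<mu> BX g) (distr \<nu> BX g)"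
      using fin by (intro W_le_tv) auto
    also have "tv_mass_diff (distr \<mu> BX g) (distr \<nu> BX g) \<le> tv_mass_diff (D \<mu>) (D \<nu>)"
      unfolding gD[OF mu(1)] gD[OF nu(1)]
      using D[OF mu(1,2)] D[OF nu(1,2)] by (intro tv_mass_diff_distr dm') auto
    also note tvn'(2)
    finally have mid: "W (distr \<mu> BX g) (distr \<nu> BX g) \<le>
        a * (\<Sum>i. \<bar>measure \<mu> {x\<in>X. cell \<delta> x = i} - measure \<nu> {x\<in>X. cell \<delta> x = i}\<bar>)"
      using a by simp
    have "W \<mu> \<nu> \<le> W \<mu> (distr \<mu> BX g) + W (distr \<mu> BX g) \<nu>"
      using mu nu fin by (intro W_triangle) auto
    moreover have "W (distr \<mu> BX g) \<nu> \<le> W (distr \<mu> BX g) (distr \<nu> BX g) + W (distr \<nu> BX g) \<nu>"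
      using mu nu fin by (intro W_triangle) auto
    ultimately show ?thesis
      using mid close[OF mu] close[OF nu] W_commute[of \<nu> "distr \<nu> BX g"] by linarith
  qed
qed

end

lemma distr_in_measures_p_C:
  assumes S: "wasserstein_space X d p a b" and T: "wasserstein_space Y e p a b"
    and f: "f \<in> metric_borel X d \<rightarrow>\<^sub>M metric_borel Y e"
    and mu: "\<mu> \<in> measures_p_C X d p C"
  shows "distr \<mu> (metric_borel Y e) f \<in> measures_p_C Y e p C" "f \<in> \<mu> \<rightarrow>\<^sub>M metric_borel Y e"
proof -
  interpret S: wasserstein_space X d p a b by (rule S)
  interpret T: wasserstein_space Y e p a b by (rule T)
  have m: "sets \<mu> = sets S.BX" "finite_measure \<mu>" "mass \<mu> \<le> C"
    using mu by (auto simp: S.measures_p_C_iff)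
  show fm: "f \<in> \<mu> \<rightarrow>\<^sub>M T.BX" using f m(1) by (simp cong: measurable_cong_sets)
  have "mass (distr \<mu> T.BX f) = mass \<mu>"
  proof -
    have "f -` space T.BX \<inter> space \<mu> = space \<mu>" using measurable_space[OF fm] by auto
    then show ?thesis using measure_distr[OF fm sets.top] by (simp add: mass_def)
  qed
  then show "distr \<mu> T.BX f \<in> measures_p_C Y e p C"
    using m finite_measure.finite_measure_distr[OF m(2) fm] by (simp add: T.measures_p_C_iff)
qed

text \<open>The sets \<open>{\<nu>. \<Sum>\<^sub>i |\<nu>(A\<^sub>i) - q\<^sub>i| < 1/(l+1)}\<close>, with the cells \<open>A\<^sub>i\<close> of radius \<open>1/(k+1)\<close> and \<open>q\<close> a rational sequence
  of finite support, form a countable family. By density of these sequences and by \<open>W_le_cells\<close>, an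
  open set is the union of the members that it contains. The preimage of a
  member is \<open>{\<mu>. \<Sum>\<^sub>i |\<mu>(f\<^sup>-\<^sup>1(A\<^sub>i)) - q\<^sub>i| < 1/(l+1)}\<close>, which is Borel because the evaluation maps are.\<close>

lemma pushforward_measurable:
  assumes S: "wasserstein_space X d p a b" and T: "wasserstein_space Y e p a b"
    and f: "f \<in> metric_borel X d \<rightarrow>\<^sub>M metric_borel Y e" and C: "0 < C"
  shows "(\<lambda>\<mu>. distr \<mu> (metric_borel Y e) f) \<in>
    metric_borel (measures_p_C X d p C) (gen_wasserstein X d p a b) \<rightarrow>\<^sub>M
    metric_borel (measures_p_C Y e p C) (gen_wasserstein Y e p a b)"
proof -
  interpret S: wasserstein_space X d p a b by (rule S)
  interpret T: wasserstein_space Y e p a b by (rule T)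
  note p = S.p and a = S.a and b = S.b
  let ?F = "\<lambda>\<mu>. distr \<mu> T.BX f"
  let ?c = "\<lambda>k \<nu> i. measure \<nu> {y\<in>Y. T.cell (inverse (real (Suc k))) y = i}"
  let ?N = "\<lambda>k q \<nu>. (\<Sum>i. \<bar>?c k \<nu> i - list_seq q i\<bar>)"
  have cellm: "{y\<in>Y. T.cell \<delta> y = i} \<in> sets T.BX" for \<delta> i
  proof -
    have "{y\<in>space T.BX. T.cell \<delta> y = i} \<in> sets T.BX" by measurable
    then show ?thesis by simp
  qed
  have c_sums: "(?c k \<nu>) sums mass \<nu>" if "\<nu> \<in> measures_p_C Y e p C" for k \<nu>
    using that by (intro T.cell_mass_sums) (auto simp: T.measures_p_C_iff)
  have sumN: "summable (\<lambda>i. \<bar>?c k \<nu> i - list_seq q i\<bar>)" if "\<nu> \<in> measures_p_C Y e p C" for k q \<nu>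
  proof (rule summable_comparison_test'[of "\<lambda>i. ?c k \<nu> i + \<bar>list_seq q i\<bar>" 0])
    show "summable (\<lambda>i. ?c k \<nu> i + \<bar>list_seq q i\<bar>)"
      using c_sums[OF that]
      by (intro summable_add summable_finite[of "{..<length q}"] sums_summable) (auto simp: list_seq_def)
    show "norm \<bar>?c k \<nu> i - list_seq q i\<bar> \<le> ?c k \<nu> i + \<bar>list_seq q i\<bar>" if "0 \<le> i" for i
      by (simp add: order_trans[OF abs_triangle_ineq4])
  qed
  show ?thesis
  proof (rule measurable_into_borel_of)
    show "?F \<in> space (S.BM C) \<rightarrow> topspace (Metric_space.mtopology (measures_p_C Y e p C) T.W)"
      using distr_in_measures_p_C[OF S T f]
      by (simp add: S.space_BM Metric_space.topspace_mtopology[OF T.W_metric] del: space_borel_of)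
    fix U assume U: "openin (Metric_space.mtopology (measures_p_C Y e p C) T.W) U"
    let ?J = "{(k, q, l). \<forall>\<nu>\<in>measures_p_C Y e p C. ?N k q \<nu> < inverse (real (Suc l)) \<longrightarrow> \<nu> \<in> U}"
    let ?V = "\<lambda>k q l. {\<mu>\<in>space (S.BM C). ?N k q (?F \<mu>) < inverse (real (Suc l))}"
    have V: "?V k q l \<in> sets (S.BM C)" for k q l
    proof -
      have "(\<lambda>\<mu>. measure \<mu> (f -` {y\<in>Y. T.cell (inverse (real (Suc k))) y = i} \<inter> X)) \<in> borel_measurable (S.BM C)" for i
        using measurable_sets[OF f cellm] by (intro S.evaluation_measurable) simp
      then have "(\<lambda>\<mu>. ?c k (?F \<mu>) i) \<in> borel_measurable (S.BM C)" for i
      proof (rule measurable_cong[THEN iffD1, rotated])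
        fix \<mu> assume "\<mu> \<in> space (S.BM C)"
        then have m: "\<mu> \<in> measures_p_C X d p C" by (simp add: S.space_BM del: space_borel_of)
        then have "space \<mu> = X" using sets_eq_imp_space_eq[of \<mu> S.BX] by (simp add: S.measures_p_C_iff)
        then show "measure \<mu> (f -` {y\<in>Y. T.cell (inverse (real (Suc k))) y = i} \<inter> X) = ?c k (?F \<mu>) i"
          using measure_distr[OF distr_in_measures_p_C(2)[OF S T f m] cellm] by simp
      qed
      then have "(\<lambda>\<mu>. ?N k q (?F \<mu>)) \<in> borel_measurable (S.BM C)"
        by (intro borel_measurable_suminf borel_measurable_abs borel_measurable_diff) auto
      then show ?thesis by measurable
    qed
    have "?F -` U \<inter> space (S.BM C) = (\<Union>(k, q, l)\<in>?J. ?V k q l)"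
    proof (intro equalityI subsetI)
      fix \<mu> assume "\<mu> \<in> (\<Union>(k, q, l)\<in>?J. ?V k q l)"
      then obtain k q l where J: "(k, q, l) \<in> ?J" and "\<mu> \<in> ?V k q l" by blast
      then have m: "\<mu> \<in> space (S.BM C)" "?N k q (?F \<mu>) < inverse (real (Suc l))" by auto
      then have "\<mu> \<in> measures_p_C X d p C" by (simp add: S.space_BM del: space_borel_of)
      then have "?F \<mu> \<in> measures_p_C Y e p C" by (rule distr_in_measures_p_C[OF S T f])
      then have "?F \<mu> \<in> U" using J m by blast
      then show "\<mu> \<in> ?F -` U \<inter> space (S.BM C)" using m by simp
    next
      fix \<mu> assume "\<mu> \<in> ?F -` U \<inter> space (S.BM C)"
      then have m: "\<mu> \<in> space (S.BM C)" "?F \<mu> \<in> U" by auto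
      then have "\<mu> \<in> measures_p_C X d p C" by (simp add: S.space_BM del: space_borel_of)
      then have Fm: "?F \<mu> \<in> measures_p_C Y e p C" by (rule distr_in_measures_p_C[OF S T f])
      obtain s where s: "0 < s" "Metric_space.mball (measures_p_C Y e p C) T.W (?F \<mu>) s \<subseteq> U"
        using iffD1[OF Metric_space.openin_mtopology[OF T.W_metric] U] m(2) by auto
      define K where "K = 2 * (b * C powr (1 / p))"
      have K: "0 < K" using b C by (simp add: K_def)
      obtain k where k: "inverse (real (Suc k)) < s / (2 * K)"
        using reals_Archimedean[of "s / (2 * K)"] s K by auto
      obtain l where l: "inverse (real (Suc l)) < s / (4 * a)"
        using reals_Archimedean[of "s / (4 * a)"] s a by auto
      obtain q where q: "?N k q (?F \<mu>) < inverse (real (Suc l))"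
        using list_seq_dense[OF sums_summable[OF c_sums[OF Fm, of k]], of "inverse (real (Suc l))"] by auto
      have "\<nu> \<in> U" if nu: "\<nu> \<in> measures_p_C Y e p C" and N: "?N k q \<nu> < inverse (real (Suc l))" for \<nu>
      proof -
        have "(\<Sum>i. \<bar>?c k (?F \<mu>) i - ?c k \<nu> i\<bar>) \<le> (\<Sum>i. \<bar>?c k (?F \<mu>) i - list_seq q i\<bar> + \<bar>?c k \<nu> i - list_seq q i\<bar>)"
        proof (rule suminf_le)
          show s2: "summable (\<lambda>i. \<bar>?c k (?F \<mu>) i - list_seq q i\<bar> + \<bar>?c k \<nu> i - list_seq q i\<bar>)"
            by (intro summable_add sumN Fm nu)
          show le: "\<bar>?c k (?F \<mu>) i - ?c k \<nu> i\<bar> \<le> \<bar>?c k (?F \<mu>) i - list_seq q i\<bar> + \<bar>?c k \<nu> i - list_seq q i\<bar>" for i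
            by linarith
          show "summable (\<lambda>i. \<bar>?c k (?F \<mu>) i - ?c k \<nu> i\<bar>)"
            by (rule summable_comparison_test'[OF s2, of 0]) (use le in simp)
        qed
        also have "\<dots> = ?N k q (?F \<mu>) + ?N k q \<nu>"
          by (rule suminf_add[symmetric]) (intro sumN Fm nu)+
        also have "\<dots> < s / (4 * a) + s / (4 * a)" using q N l by linarith
        also have "\<dots> = s / (2 * a)" by simp
        finally have "a * (\<Sum>i. \<bar>?c k (?F \<mu>) i - ?c k \<nu> i\<bar>) < s / 2" using a by (simp add: field_simps)
        moreover have "K * inverse (real (Suc k)) < s / 2"
        proof -
          have "K * (s / (2 * K)) = s / 2" using K by simp
          then show ?thesis using mult_strict_left_mono[OF k K] by (simp only:)
        qed
        moreover have "T.W (?F \<mu>) \<nu> \<le> 2 * (b * (C powr (1 / p) * inverse (real (Suc k)))) + a * (\<Sum>i. \<bar>?c k (?F \<mu>) i - ?c k \<nu> i\<bar>)"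
          using Fm nu C by (intro T.W_le_cells) (auto simp: T.measures_p_C_iff)
        moreover have "2 * (b * (C powr (1 / p) * inverse (real (Suc k)))) = K * inverse (real (Suc k))"
          by (simp add: K_def)
        ultimately have "T.W (?F \<mu>) \<nu> < s" by linarith
        then show "\<nu> \<in> U" using s(2) Fm nu by (auto simp: Metric_space.in_mball[OF T.W_metric])
      qed
      then have "(k, q, l) \<in> ?J" by blast
      moreover have "\<mu> \<in> ?V k q l" using m q by simp
      ultimately show "\<mu> \<in> (\<Union>(k, q, l)\<in>?J. ?V k q l)" by blast
    qed
    also have "\<dots> \<in> sets (S.BM C)"
    proof (rule sets.countable_UN')
      show "countable ?J" by (rule countableI_type)
    qed (use V in auto)
    finally show "?F -` U \<inter> space (S.BM C) \<in> sets (S.BM C)" .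
  qed
qed

section \<open>Approximations of the induced actions\<close>

lemma continuous_action_measurable:
  assumes G: "topological_group G T" and act: "continuous_action G T X d \<alpha>" and M: "Metric_space X d"
    and g: "g \<in> carrier G"
  shows "\<alpha> g \<in> metric_borel X d \<rightarrow>\<^sub>M metric_borel X d"
proof -
  interpret Metric_space X d by (rule M)
  have "continuous_map mtopology (prod_topology T mtopology) (\<lambda>x. (g, x))"
    using g topological_group.topspace_eq[OF G] by (intro continuous_map_pairedI) auto
  moreover have "continuous_map (prod_topology T mtopology) mtopology (\<lambda>(g, x). \<alpha> g x)"
    using act by (simp add: continuous_action_def)
  ultimately have "continuous_map mtopology mtopology ((\<lambda>(g, x). \<alpha> g x) \<circ> (\<lambda>x. (g, x)))"
    by (rule continuous_map_compose)
  then show ?thesis by (intro continuous_map_measurable) (simp add: comp_def)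
qed

text \<open>On each cell \<open>g\<close> is constant, with a value that \<open>f\<close> maps near the centre of the cell. So \<open>g\<close>
  is measurable, whatever the choice of these values.\<close>

lemma eps_isometry_measurable_inverse:
  assumes S: "wasserstein_space X d p a b" and T: "wasserstein_space Y e p a b"
    and f: "eps_isometry X d Y e \<epsilon> f" and eps: "0 < \<epsilon>"
  obtains g where "g \<in> metric_borel Y e \<rightarrow>\<^sub>M metric_borel X d"
    "\<And>y. y \<in> Y \<Longrightarrow> e (f (g y)) y \<le> 2 * \<epsilon>"
proof (cases "Y = {}")
  case True
  interpret T: wasserstein_space Y e p a b by (rule T)
  have "space T.BX = Y" by simp
  then have sp: "space T.BX = {}" unfolding True .
  \<comment> \<open>Any function is measurable on the empty space.\<close>
  have "(\<lambda>_. undefined) \<in> T.BX \<rightarrow>\<^sub>M metric_borel X d"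
    by (auto simp: measurable_def sp simp del: space_borel_of)
  then show thesis using that True by auto
next
  case False
  interpret S: wasserstein_space X d p a b by (rule S)
  interpret T: wasserstein_space Y e p a b by (rule T)
  have "\<exists>x\<in>X. e (f x) (T.dense_seq i) \<le> \<epsilon>" for i
    using f T.dense_seq(1)[OF False] by (auto simp: eps_isometry_def)
  then obtain h where h: "\<And>i. h i \<in> X" "\<And>i. e (f (h i)) (T.dense_seq i) \<le> \<epsilon>" by metis
  have hm: "h \<in> count_space UNIV \<rightarrow>\<^sub>M S.BX" using h(1) by auto
  show thesis
  proof (rule that[of "\<lambda>y. h (T.cell \<epsilon> y)"])
    show "(\<lambda>y. h (T.cell \<epsilon> y)) \<in> T.BX \<rightarrow>\<^sub>M S.BX"
      by (rule measurable_compose[OF T.cell_measurable hm])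
    fix y assume y: "y \<in> Y"
    let ?i = "T.cell \<epsilon> y"
    have "f (h ?i) \<in> Y" using f h(1) by (auto simp: eps_isometry_def)
    then have "e (f (h ?i)) y \<le> e (f (h ?i)) (T.dense_seq ?i) + e y (T.dense_seq ?i)"
      using y T.dense_seq(1)[OF False] by (intro T.triangle') auto
    also have "\<dots> \<le> \<epsilon> + \<epsilon>"
      using h(2)[of ?i] T.dist_cell[OF y eps] by (intro add_mono) auto
    finally show "e (f (h ?i)) y \<le> 2 * \<epsilon>" by simp
  qed
qed

text \<open>With \<open>K = b (3C + 1)\<^bsup>1/p\<^esup>\<close>, the push-forward enlarges distances by at most \<open>K \<epsilon>\<close>. For the opposite
  bound, \<open>g\<close> satisfies \<open>d (g y) (g y') \<le> e y y' + 5 \<epsilon>\<close> and \<open>g \<circ> f\<close> is \<open>3 \<epsilon>\<close>-close to the identity, so passing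
  from \<open>\<mu>\<close> and \<open>\<nu>\<close> to their images under \<open>g \<circ> f\<close> costs \<open>K (3 + 5 + 3) \<epsilon>\<close> in total. Every \<open>\<nu>\<close> is approximated by the push-forward of
  \<open>g\<^sub>\<sharp>\<nu>\<close>, as \<open>f \<circ> g\<close> is \<open>2 \<epsilon>\<close>-close to the identity.\<close>

lemma induced_measurable_GH_approximation:
  assumes G: "topological_group G T"
    and S: "wasserstein_space X d p a b" and R: "wasserstein_space Y e p a b"
    and actX: "continuous_action G T X d \<alpha>" and actY: "continuous_action G T Y e \<beta>"
    and f: "measurable_GH_approximation G X d \<alpha> Y e \<beta> \<epsilon> f"
    and eps: "0 < \<epsilon>" and C: "0 < C"
  shows "measurable_GH_approximation G
     (measures_p_C X d p C) (gen_wasserstein X d p a b) (induced_action X d p C \<alpha>)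
     (measures_p_C Y e p C) (gen_wasserstein Y e p a b) (induced_action Y e p C \<beta>)
     (b * ((3 * C + 1) powr (1 / p) * (11 * \<epsilon>))) (\<lambda>\<mu>. distr \<mu> (metric_borel Y e) f)"
proof -
  interpret S: wasserstein_space X d p a b by (rule S)
  interpret R: wasserstein_space Y e p a b by (rule R)
  note p = S.p and a = S.a and b = S.b
  let ?F = "\<lambda>\<mu>. distr \<mu> R.BX f"
  let ?MX = "measures_p_C X d p C" and ?MY = "measures_p_C Y e p C"
  define K where "K = b * (3 * C + 1) powr (1 / p)"
  have K: "0 < K" using b C by (simp add: K_def)
  have iso: "eps_isometry X d Y e \<epsilon> f"
    and equi: "\<And>g x. g \<in> carrier G \<Longrightarrow> x \<in> X \<Longrightarrow> e (f (\<alpha> g x)) (\<beta> g (f x)) \<le> \<epsilon>"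
    and fm: "f \<in> S.BX \<rightarrow>\<^sub>M R.BX"
    using f by (auto simp: measurable_GH_approximation_def GH_approximation_def)
  have fX: "f x \<in> Y" if "x \<in> X" for x using iso that by (auto simp: eps_isometry_def)
  have fd: "e (f x) (f x') \<le> d x x' + \<epsilon>" "d x x' \<le> e (f x) (f x') + \<epsilon>" if "x \<in> X" "x' \<in> X" for x x'
    using iso that unfolding eps_isometry_def by (force simp: abs_le_iff)+
  obtain g where gm: "g \<in> R.BX \<rightarrow>\<^sub>M S.BX" and g: "\<And>y. y \<in> Y \<Longrightarrow> e (f (g y)) y \<le> 2 * \<epsilon>"
    using eps_isometry_measurable_inverse[OF S R iso eps] by blast
  have gY: "g y \<in> X" if "y \<in> Y" for y using measurable_space[OF gm] that by simp
  have gd: "d (g y) (g y') \<le> e y y' + 5 * \<epsilon>" if "y \<in> Y" "y' \<in> Y" for y y'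
    using fd(2)[OF gY gY, OF that] g[OF that(1)] g[OF that(2)]
      R.triangle[OF fX[OF gY] that(1) fX[OF gY], OF that]
      R.triangle'[OF that(1) that(2) fX[OF gY], OF that(2)]
    by (simp add: R.commute)
  have MX: "sets \<mu> = sets S.BX" "finite_measure \<mu>" "mass \<mu> \<le> C" "mass \<mu> \<le> 3 * C + 1" "space \<mu> = X"
    if "\<mu> \<in> ?MX" for \<mu>
    using that C sets_eq_imp_space_eq[of \<mu> S.BX] by (auto simp: S.measures_p_C_iff)
  have MY: "sets \<mu> = sets R.BX" "finite_measure \<mu>" "mass \<mu> \<le> C" "mass \<mu> \<le> 3 * C + 1" "space \<mu> = Y"
    if "\<mu> \<in> ?MY" for \<mu>
    using that C sets_eq_imp_space_eq[of \<mu> R.BX] by (auto simp: R.measures_p_C_iff)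
  have F: "?F \<mu> \<in> ?MY" "f \<in> \<mu> \<rightarrow>\<^sub>M R.BX" if "\<mu> \<in> ?MX" for \<mu>
    using distr_in_measures_p_C[OF S R fm that] by auto
  have Gm: "distr \<nu> S.BX g \<in> ?MX" "g \<in> \<nu> \<rightarrow>\<^sub>M S.BX" if "\<nu> \<in> ?MY" for \<nu>
    using distr_in_measures_p_C[OF R S gm that] by auto
  have upper: "R.W (?F \<mu>) (?F \<nu>) \<le> S.W \<mu> \<nu> + K * \<epsilon>" if "\<mu> \<in> ?MX" "\<nu> \<in> ?MX" for \<mu> \<nu>
    using W_distr_le[OF S R fm fd(1) eps MX(1-3)[OF that(1)] MX(1-3)[OF that(2)]]
    by (simp add: K_def mult.assoc)
  have roundtrip: "S.W \<mu> (distr (?F \<mu>) S.BX g) \<le> K * (3 * \<epsilon>)" if m: "\<mu> \<in> ?MX" for \<mu>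
  proof -
    have id: "(\<lambda>x. x) \<in> \<mu> \<rightarrow>\<^sub>M S.BX" using MX(1)[OF m] by (simp cong: measurable_cong_sets)
    have "S.W (distr \<mu> S.BX (\<lambda>x. x)) (distr \<mu> S.BX (g \<circ> f)) \<le> b * ((3 * C + 1) powr (1 / p) * (3 * \<epsilon>))"
    proof (rule S.W_distr_close[OF MX(2,4)[OF m] id measurable_comp[OF F(2)[OF m] gm]])
      fix x assume "x \<in> space \<mu>"
      then have x: "x \<in> X" by (simp add: MX(5)[OF m])
      show "d x ((g \<circ> f) x) \<le> 3 * \<epsilon>"
        using fd(2)[OF x gY[OF fX[OF x]]] g[OF fX[OF x]] by (simp add: R.commute)
    qed (use eps C in auto)
    moreover have "distr \<mu> S.BX (\<lambda>x. x) = \<mu>" using MX[OF m] by (intro distr_id2) auto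
    moreover have "distr (?F \<mu>) S.BX g = distr \<mu> S.BX (g \<circ> f)" by (rule distr_distr[OF gm F(2)[OF m]])
    ultimately show ?thesis by (simp add: K_def mult.assoc)
  qed
  have lower: "S.W \<mu> \<nu> \<le> R.W (?F \<mu>) (?F \<nu>) + K * (11 * \<epsilon>)" if m: "\<mu> \<in> ?MX" and n: "\<nu> \<in> ?MX" for \<mu> \<nu>
  proof -
    let ?H = "\<lambda>\<mu>. distr (?F \<mu>) S.BX g"
    have H: "?H \<mu> \<in> ?MX" "?H \<nu> \<in> ?MX" using Gm(1) F(1) m n by auto
    note tri = Metric_space.triangle[OF S.W_metric]
    have "S.W \<mu> \<nu> \<le> S.W \<mu> (?H \<mu>) + S.W (?H \<mu>) \<nu>" by (rule tri[OF m H(1) n])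
    also have "S.W (?H \<mu>) \<nu> \<le> S.W (?H \<mu>) (?H \<nu>) + S.W (?H \<nu>) \<nu>" by (rule tri[OF H(1,2) n])
    also have "S.W (?H \<mu>) (?H \<nu>) \<le> R.W (?F \<mu>) (?F \<nu>) + b * ((3 * C + 1) powr (1 / p) * (5 * \<epsilon>))"
      using eps by (intro W_distr_le[OF R S gm gd _ MY(1-3)[OF F(1)[OF m]] MY(1-3)[OF F(1)[OF n]]]) auto
    also have "S.W (?H \<nu>) \<nu> = S.W \<nu> (?H \<nu>)" by (rule S.W_commute)
    finally show ?thesis using roundtrip[OF m] roundtrip[OF n] by (simp add: K_def algebra_simps)
  qed
  have surj: "\<exists>\<mu>\<in>?MX. R.W (?F \<mu>) \<nu> \<le> K * (2 * \<epsilon>)" if n: "\<nu> \<in> ?MY" for \<nu>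
  proof
    have id: "(\<lambda>x. x) \<in> \<nu> \<rightarrow>\<^sub>M R.BX" using MY(1)[OF n] by (simp cong: measurable_cong_sets)
    have "R.W (distr \<nu> R.BX (f \<circ> g)) (distr \<nu> R.BX (\<lambda>x. x)) \<le> b * ((3 * C + 1) powr (1 / p) * (2 * \<epsilon>))"
      by (rule R.W_distr_close[OF MY(2,4)[OF n] measurable_comp[OF Gm(2)[OF n] fm] id])
        (use eps C g MY(5)[OF n] in auto)
    moreover have "distr \<nu> R.BX (\<lambda>x. x) = \<nu>" using MY[OF n] by (intro distr_id2) auto
    moreover have "?F (distr \<nu> S.BX g) = distr \<nu> R.BX (f \<circ> g)" by (rule distr_distr[OF fm Gm(2)[OF n]])
    ultimately show "R.W (?F (distr \<nu> S.BX g)) \<nu> \<le> K * (2 * \<epsilon>)" by (simp add: K_def mult.assoc)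
    show "distr \<nu> S.BX g \<in> ?MX" by (rule Gm(1)[OF n])
  qed
  have equiv: "R.W (?F (induced_action X d p C \<alpha> h \<mu>)) (induced_action Y e p C \<beta> h (?F \<mu>)) \<le> K * \<epsilon>"
    if h: "h \<in> carrier G" and m: "\<mu> \<in> ?MX" for h \<mu>
  proof -
    have am: "\<alpha> h \<in> S.BX \<rightarrow>\<^sub>M S.BX"
      by (rule continuous_action_measurable[OF G actX S.Metric_space_axioms h])
    have bm: "\<beta> h \<in> R.BX \<rightarrow>\<^sub>M R.BX"
      by (rule continuous_action_measurable[OF G actY R.Metric_space_axioms h])
    have am': "\<alpha> h \<in> \<mu> \<rightarrow>\<^sub>M S.BX" using am MX(1)[OF m] by (simp cong: measurable_cong_sets)
    have "?F (induced_action X d p C \<alpha> h \<mu>) = distr \<mu> R.BX (f \<circ> \<alpha> h)"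
      using m distr_distr[OF fm am'] by (simp add: induced_action_def)
    moreover have "induced_action Y e p C \<beta> h (?F \<mu>) = distr \<mu> R.BX (\<beta> h \<circ> f)"
      using F[OF m] distr_distr[OF bm F(2)[OF m]] by (simp add: induced_action_def)
    moreover have "R.W (distr \<mu> R.BX (f \<circ> \<alpha> h)) (distr \<mu> R.BX (\<beta> h \<circ> f)) \<le> b * ((3 * C + 1) powr (1 / p) * \<epsilon>)"
      by (rule R.W_distr_close[OF MX(2,4)[OF m] measurable_comp[OF am' fm] measurable_comp[OF F(2)[OF m] bm]])
        (use eps C equi[OF h] MX(5)[OF m] in auto)
    ultimately show ?thesis by (simp add: K_def mult.assoc)
  qed
  have small: "K * \<epsilon> \<le> K * (11 * \<epsilon>)" "K * (2 * \<epsilon>) \<le> K * (11 * \<epsilon>)" using K eps by auto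
  have K11: "b * ((3 * C + 1) powr (1 / p) * (11 * \<epsilon>)) = K * (11 * \<epsilon>)" by (simp add: K_def mult.assoc)
  have "eps_isometry ?MX S.W ?MY R.W (K * (11 * \<epsilon>)) ?F"
    unfolding eps_isometry_def
  proof (intro conjI ballI)
    show "?F \<in> ?MX \<rightarrow> ?MY" using F(1) by blast
    show "\<bar>R.W (?F \<mu>) (?F \<nu>) - S.W \<mu> \<nu>\<bar> \<le> K * (11 * \<epsilon>)" if "\<mu> \<in> ?MX" "\<nu> \<in> ?MX" for \<mu> \<nu>
      using upper[OF that] lower[OF that] small by linarith
    show "\<exists>\<mu>\<in>?MX. R.W (?F \<mu>) \<nu> \<le> K * (11 * \<epsilon>)" if "\<nu> \<in> ?MY" for \<nu>
      using surj[OF that] small by (meson order_trans)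
  qed
  moreover have "R.W (?F (induced_action X d p C \<alpha> h \<mu>)) (induced_action Y e p C \<beta> h (?F \<mu>)) \<le> K * (11 * \<epsilon>)"
    if "h \<in> carrier G" "\<mu> \<in> ?MX" for h \<mu>
    using equiv[OF that] small by linarith
  ultimately show ?thesis
    unfolding measurable_GH_approximation_def GH_approximation_def K11
    using pushforward_measurable[OF S R fm C] by blast
qed

theorem theorem1p6:
  fixes G :: "('g, 'm) monoid_scheme" and T :: "'g topology"
    and X :: "nat \<Rightarrow> 'a set" and d :: "nat \<Rightarrow> 'a \<Rightarrow> 'a \<Rightarrow> real" and \<alpha> :: "nat \<Rightarrow> 'g \<Rightarrow> 'a \<Rightarrow> 'a"
    and X' :: "'b set" and d' :: "'b \<Rightarrow> 'b \<Rightarrow> real" and \<alpha>' :: "'g \<Rightarrow> 'b \<Rightarrow> 'b"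
    and C p a b :: real
  assumes "topological_group G T"
    and "\<And>n. bounded_polish_metric_space (X n) (d n)"
    and "\<And>n. continuous_action G T (X n) (d n) (\<alpha> n)"
    and "C > 0" and "p \<ge> 1" and "a > 0" and "b > 0"
    and "bounded_polish_metric_space X' d'"
    and "continuous_action G T X' d' \<alpha>'"
    and "(\<lambda>n. d_mGH G (X n) (d n) (\<alpha> n) X' d' \<alpha>') \<longlonglongrightarrow> 0"
  shows "(\<lambda>n. d_mGH G
            (measures_p_C (X n) (d n) p C) (gen_wasserstein (X n) (d n) p a b)
            (induced_action (X n) (d n) p C (\<alpha> n))
            (measures_p_C X' d' p C) (gen_wasserstein X' d' p a b)
            (induced_action X' d' p C \<alpha>')) \<longlonglongrightarrow> 0"
proof (rule order_tendstoI)
  define K where "K = b * ((3 * C + 1) powr (1 / p) * 11)"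
  have K: "0 < K" using assms(4,7) by (simp add: K_def)
  have spaces: "wasserstein_space (X n) (d n) p a b" "wasserstein_space X' d' p a b" for n
    using assms(2,5-8) bounded_polish_imp
    by (auto simp: wasserstein_space_def wasserstein_space_axioms_def)
  let ?D = "\<lambda>n. d_mGH G
            (measures_p_C (X n) (d n) p C) (gen_wasserstein (X n) (d n) p a b)
            (induced_action (X n) (d n) p C (\<alpha> n))
            (measures_p_C X' d' p C) (gen_wasserstein X' d' p a b)
            (induced_action X' d' p C \<alpha>')"
  {
    fix t :: ereal assume "t < 0"
    moreover have "0 \<le> ?D n" for n unfolding d_mGH_def by (rule INF_greatest) auto
    ultimately show "\<forall>\<^sub>F n in sequentially. t < ?D n" by (intro always_eventually allI) (rule less_le_trans)
  }
  fix t :: ereal assume "0 < t"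
  then obtain r where r: "0 < r" "ereal r < t"
    by (metis ereal_dense2 ereal_less(2) order_less_trans)
  have "\<forall>\<^sub>F n in sequentially. d_mGH G (X n) (d n) (\<alpha> n) X' d' \<alpha>' < ereal (r / K)"
    using order_tendstoD(2)[OF assms(10), of "ereal (r / K)"] r K by simp
  then show "\<forall>\<^sub>F n in sequentially. ?D n < t"
  proof eventually_elim
    fix n assume "d_mGH G (X n) (d n) (\<alpha> n) X' d' \<alpha>' < ereal (r / K)"
    then obtain \<epsilon> f h where e: "0 < \<epsilon>" "\<epsilon> < r / K"
      and f: "measurable_GH_approximation G (X n) (d n) (\<alpha> n) X' d' \<alpha>' \<epsilon> f"
      and h: "measurable_GH_approximation G X' d' \<alpha>' (X n) (d n) (\<alpha> n) \<epsilon> h"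
      unfolding d_mGH_def INF_less_iff by auto
    have Ke: "b * ((3 * C + 1) powr (1 / p) * (11 * \<epsilon>)) = K * \<epsilon>" by (simp add: K_def)
    have "?D n \<le> ereal (K * \<epsilon>)"
      unfolding d_mGH_def
    proof (rule INF_lower, intro CollectI conjI exI)
      show "0 < K * \<epsilon>" using K e by simp
    qed (rule induced_measurable_GH_approximation[OF assms(1) spaces(1,2) assms(3,9) f e(1) assms(4), unfolded Ke]
        induced_measurable_GH_approximation[OF assms(1) spaces(2,1) assms(9,3) h e(1) assms(4), unfolded Ke])+
    also have "K * \<epsilon> < r" using e K by (simp add: field_simps)
    then have "ereal (K * \<epsilon>) < ereal r" by simp
    also note r(2)
    finally show "?D n < t" .
  qed
qed

end
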